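(* There exists a smooth map $F : C^\infty(\mathbb{R},\mathbb{R}^{\geq 0}) \to \mathbb{R}^{\geq 0}$ of diffeological spaces such that, for every $f \in C^\infty(\mathbb{R},\mathbb{R}^{\geq 0})$, $F(f)=0$ if and only if $f(x)=0$ for some $x \in [0,1]$.
   Context: A diffeological space is a set $X$ with a specified set of functions $U \to X$ (plots) for each open $U \subseteq \mathbb{R}^n$, $n \in \mathbb{N}$, such that constant functions are plots, precomposing a plot with a smooth map between open subsets of Euclidean spaces gives a plot, and a function that is locally a plot is a plot. A map between diffeological spaces is smooth if it sends plots to plots by composition. $\mathbb{R}$ has the standard diffeology (plots are the usual smooth functions $U \to \mathbb{R}$), and $\mathbb{R}^{\geq 0}$ has the sub-diffeology of $\mathbb{R}$: its plots are the smooth functions $U \to \mathbb{R}$ with non-negative values. $C^\infty(\mathbb{R},\mathbb{R}^{\geq 0})$ is the set of smooth non-negative functions $\mathbb{R} \to \mathbb{R}$, with the functional diffeology: $p : U \to C^\infty(\mathbb{R},\mathbb{R}^{\geq 0})$ is a plot iff $U \times \mathbb{R} \to \mathbb{R}$, $(u,x) \mapsto p(u)(x)$, is smooth in the usual sense. *)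

theory Defs
  imports "HOL-Analysis.Analysis"
begin

text \<open>
  Plots have domains in Euclidean spaces of arbitrary dimension, so \<open>n\<close>-dimensional space has to be
  indexed by a natural number rather than by a type. We use the library's
  \<^const>\<open>Euclidean_space\<close>: its points are the sequences \<open>x :: nat \<Rightarrow> real\<close> with \<open>x i = 0\<close> for all
  \<open>i \<ge> n\<close>. A function on \<open>U\<close> is represented by a total function of which only the values on \<open>U\<close>
  matter.
\<close>

section \<open>Smooth functions on open subsets of Euclidean spaces\<close>

definition partial_deriv :: "nat \<Rightarrow> ((nat \<Rightarrow> real) \<Rightarrow> real) \<Rightarrow> (nat \<Rightarrow> real) \<Rightarrow> real" where
  "partial_deriv i f x = deriv (\<lambda>s. f (x(i := s))) (x i)"

text \<open>
  \<open>Ck_on k n U f\<close>: on the open subset \<open>U\<close> of \<open>n\<close>-space, all partial derivatives of \<open>f\<close> of order at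
  most \<open>k\<close> exist and are continuous. The topology that \<^const>\<open>continuous_on\<close> uses on
  \<open>nat \<Rightarrow> real\<close> is the product topology, which induces the usual one on \<open>n\<close>-space.
\<close>

primrec Ck_on :: "nat \<Rightarrow> nat \<Rightarrow> (nat \<Rightarrow> real) set \<Rightarrow> ((nat \<Rightarrow> real) \<Rightarrow> real) \<Rightarrow> bool" where
  "Ck_on 0 n U f \<longleftrightarrow> continuous_on U f"
| "Ck_on (Suc k) n U f \<longleftrightarrow> continuous_on U f \<and>
     (\<forall>i<n. (\<forall>x\<in>U. (\<lambda>s. f (x(i := s))) field_differentiable at (x i)) \<and>
            Ck_on k n U (partial_deriv i f))"

definition smooth_on :: "nat \<Rightarrow> (nat \<Rightarrow> real) set \<Rightarrow> ((nat \<Rightarrow> real) \<Rightarrow> real) \<Rightarrow> bool" where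
  "smooth_on n U f \<longleftrightarrow> (\<forall>k. Ck_on k n U f)"

definition smooth_real_fun :: "(real \<Rightarrow> real) \<Rightarrow> bool" where
  "smooth_real_fun f \<longleftrightarrow> (\<forall>k x. (deriv ^^ k) f field_differentiable at x)"


section \<open>Calculus\<close>

lemma Euclidean_space_eq: "Euclidean_space n = top_of_set (topspace (Euclidean_space n))"
  by (simp add: Euclidean_space_def euclidean_product_topology)

lemma openin_Euclidean_subset: "openin (Euclidean_space n) U \<Longrightarrow> x \<in> U \<Longrightarrow> i \<ge> n \<Longrightarrow> x i = 0"
  using openin_subset topspace_Euclidean_space by blast

lemma openin_Euclidean_box:
  assumes U: "openin (Euclidean_space n) U" and a: "a \<in> U"
  shows "\<exists>\<delta>>0. \<forall>x\<in>topspace (Euclidean_space n). (\<forall>i<n. \<bar>x i - a i\<bar> < \<delta>) \<longrightarrow> x \<in> U"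
proof -
  obtain T where T: "openin (powertop_real UNIV) T" "U = T \<inter> {x. \<forall>i\<ge>n. x i = 0}"
    using U unfolding Euclidean_space_def openin_subtopology by blast
  have "a \<in> T" using T(2) a by simp
  then obtain V where V': "\<forall>i\<in>UNIV. openin euclideanreal (V i)"
    and V: "a \<in> Pi\<^sub>E UNIV V" "Pi\<^sub>E UNIV V \<subseteq> T"
    using T(1)[unfolded openin_product_topology_alt, rule_format, of a] by blast
  have "\<exists>d>0. ball (a i) d \<subseteq> V i" for i
  proof -
    have "open (V i)" using V' by simp
    moreover have "a i \<in> V i" using V(1) by (simp add: PiE_iff)
    ultimately show ?thesis using open_contains_ball by blast
  qed
  then obtain d where d: "\<And>i. d i > 0" "\<And>i. ball (a i) (d i) \<subseteq> V i"
    by metis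
  define \<delta> where "\<delta> = Min (insert 1 (d ` {..<n}))"
  have "\<delta> > 0" using d by (simp add: \<delta>_def)
  moreover have "x \<in> U" if x: "x \<in> topspace (Euclidean_space n)" "\<forall>i<n. \<bar>x i - a i\<bar> < \<delta>" for x
  proof -
    have "x i \<in> V i" for i
    proof (cases "i < n")
      case True
      then have "\<delta> \<le> d i" by (auto simp: \<delta>_def)
      then have "x i \<in> ball (a i) (d i)" using x(2) True by (auto simp: dist_real_def abs_minus_commute)
      then show ?thesis using d by blast
    next
      case False
      then have "x i = a i" using x openin_Euclidean_subset[OF U a] by (simp add: topspace_Euclidean_space)
      then show ?thesis using V(1) by (simp add: PiE_iff)
    qed
    then have "x \<in> T" using V(2) by auto
    then show ?thesis using T(2) x(1) by (simp add: topspace_Euclidean_space)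
  qed
  ultimately show ?thesis by blast
qed

lemma continuous_on_Euclidean_box:
  assumes U: "openin (Euclidean_space n) U" and g: "continuous_on U (g :: _ \<Rightarrow> real)"
    and a: "a \<in> U" and e: "e > 0"
  shows "\<exists>\<delta>>0. \<forall>x\<in>topspace (Euclidean_space n). (\<forall>i<n. \<bar>x i - a i\<bar> < \<delta>) \<longrightarrow> x \<in> U \<and> \<bar>g x - g a\<bar> < e"
proof -
  have "openin (top_of_set U) (U \<inter> g -` ball (g a) e)"
    using g by (simp add: continuous_openin_preimage_gen)
  then have "openin (Euclidean_space n) (U \<inter> g -` ball (g a) e)"
    using U Euclidean_space_eq openin_trans by metis
  from openin_Euclidean_box[OF this, of a] show ?thesis
    using a e by (auto simp: dist_real_def abs_minus_commute)
qed

lemma eventually_line: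
  assumes U: "openin (Euclidean_space n) U" and x: "x \<in> U" and i: "i < n"
  shows "\<forall>\<^sub>F s in nhds (x i). x(i := s) \<in> U"
proof -
  obtain \<delta> where \<delta>: "\<delta> > 0"
    "\<And>y. y \<in> topspace (Euclidean_space n) \<Longrightarrow> (\<forall>i<n. \<bar>y i - x i\<bar> < \<delta>) \<Longrightarrow> y \<in> U"
    using openin_Euclidean_box[OF U x] by blast
  have "x(i := s) \<in> U" if "dist s (x i) < \<delta>" for s
    using that i \<delta>(1) openin_Euclidean_subset[OF U x]
    by (intro \<delta>(2)) (auto simp: topspace_Euclidean_space dist_real_def)
  then show ?thesis unfolding eventually_nhds_metric using \<delta>(1) by blast
qed

lemma Ck_on_cont: "Ck_on k n U f \<Longrightarrow> continuous_on U f"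
  by (cases k) auto

lemma Ck_on_cong:
  assumes U: "openin (Euclidean_space n) U"
  shows "Ck_on k n U f \<Longrightarrow> (\<And>x. x \<in> U \<Longrightarrow> f x = g x) \<Longrightarrow> Ck_on k n U g"
proof (induction k arbitrary: f g)
  case 0
  then show ?case by (auto cong: continuous_on_cong)
next
  case (Suc k)
  have ev: "\<forall>\<^sub>F s in nhds (x i). f (x(i := s)) = g (x(i := s))" if "x \<in> U" "i < n" for x i
    using eventually_line[OF U that] by eventually_elim (use Suc.prems in auto)
  have "partial_deriv i f x = partial_deriv i g x" if "x \<in> U" "i < n" for x i
    unfolding partial_deriv_def by (rule deriv_cong_ev[OF ev[OF that]]) simp
  moreover have "Ck_on k n U (partial_deriv i f)" if "i < n" for i
    using Suc.prems(1) that by simp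
  ultimately have "Ck_on k n U (partial_deriv i g)" if "i < n" for i
    using Suc.IH[of "partial_deriv i f" "partial_deriv i g"] that by blast
  moreover have "(\<lambda>s. g (x(i := s))) field_differentiable at (x i)" if "x \<in> U" "i < n" for x i
  proof -
    have "(\<lambda>s. f (x(i := s))) field_differentiable at (x i)"
      using Suc.prems(1) that by simp
    then show ?thesis
      unfolding field_differentiable_def using DERIV_cong_ev[OF refl ev[OF that] refl] by simp
  qed
  moreover have "continuous_on U g"
    using Ck_on_cont[OF Suc.prems(1)] Suc.prems(2) continuous_on_eq by blast
  ultimately show ?case by simp
qed

lemma Ck_on_SucI:
  assumes U: "openin (Euclidean_space n) U" and "continuous_on U f"
    and D: "\<And>i x. i < n \<Longrightarrow> x \<in> U \<Longrightarrow> ((\<lambda>s. f (x(i := s))) has_real_derivative G i x) (at (x i))"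
    and G: "\<And>i. i < n \<Longrightarrow> Ck_on k n U (G i)"
  shows "Ck_on (Suc k) n U f"
proof -
  have "partial_deriv i f x = G i x" if "i < n" "x \<in> U" for i x
    unfolding partial_deriv_def using D[OF that] by (rule DERIV_imp_deriv)
  then have "Ck_on k n U (partial_deriv i f)" if "i < n" for i
    using Ck_on_cong[OF U G[OF that]] that by simp
  then show ?thesis
    using assms by (auto simp: field_differentiable_def)
qed

lemma Ck_on_SucD:
  assumes "Ck_on (Suc k) n U f" "i < n" "x \<in> U"
  shows "((\<lambda>s. f (x(i := s))) has_real_derivative partial_deriv i f x) (at (x i))"
  using assms by (auto simp: partial_deriv_def DERIV_deriv_iff_field_differentiable)

lemma Ck_on_Suc_imp: "Ck_on (Suc k) n U f \<Longrightarrow> Ck_on k n U f"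
proof (induction k arbitrary: f)
  case (Suc k)
  then show ?case by (metis Ck_on.simps(2))
qed auto

lemma Ck_on_const: "openin (Euclidean_space n) U \<Longrightarrow> Ck_on k n U (\<lambda>x. c)"
proof (induction k arbitrary: c)
  case (Suc k)
  show ?case by (rule Ck_on_SucI[where G = "\<lambda>_ _. 0"]) (use Suc in auto)
qed auto

lemma Ck_on_coord:
  assumes "openin (Euclidean_space n) U" shows "Ck_on k n U (\<lambda>x. x i)"
proof (cases k)
  case 0
  then show ?thesis
    using continuous_on_product_coordinates continuous_on_subset by (metis Ck_on.simps(1) subset_UNIV)
next
  case (Suc k')
  have "Ck_on (Suc k') n U (\<lambda>x. x i)"
  proof (rule Ck_on_SucI[where G = "\<lambda>j x. if j = i then 1 else 0"])
    show "continuous_on U (\<lambda>x. x i)"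
      using continuous_on_product_coordinates continuous_on_subset by (metis subset_UNIV)
    show "Ck_on k' n U (\<lambda>x. if j = i then 1 else 0)" for j
      by (rule Ck_on_const) fact
  qed (use assms in auto)
  then show ?thesis using Suc by simp
qed

lemma Ck_on_add:
  assumes U: "openin (Euclidean_space n) U"
  shows "Ck_on k n U f \<Longrightarrow> Ck_on k n U g \<Longrightarrow> Ck_on k n U (\<lambda>x. f x + g x)"
proof (induction k arbitrary: f g)
  case 0
  then show ?case by (simp add: continuous_on_add)
next
  case (Suc k)
  show ?case
  proof (rule Ck_on_SucI[OF U, where G = "\<lambda>i x. partial_deriv i f x + partial_deriv i g x"])
    show "continuous_on U (\<lambda>x. f x + g x)"
      using Suc.prems by (simp add: continuous_on_add)
    show "Ck_on k n U (\<lambda>x. partial_deriv i f x + partial_deriv i g x)" if "i < n" for i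
      using Suc that by simp
    show "((\<lambda>s. f (x(i := s)) + g (x(i := s))) has_real_derivative
        partial_deriv i f x + partial_deriv i g x) (at (x i))" if "i < n" "x \<in> U" for i x
      by (intro DERIV_add Ck_on_SucD[OF Suc.prems(1) that] Ck_on_SucD[OF Suc.prems(2) that])
  qed
qed

lemma Ck_on_mult:
  assumes U: "openin (Euclidean_space n) U"
  shows "Ck_on k n U f \<Longrightarrow> Ck_on k n U g \<Longrightarrow> Ck_on k n U (\<lambda>x. f x * g x)"
proof (induction k arbitrary: f g)
  case 0
  then show ?case by (simp add: continuous_on_mult)
next
  case (Suc k)
  show ?case
  proof (rule Ck_on_SucI[OF U, where G = "\<lambda>i x. partial_deriv i f x * g x + partial_deriv i g x * f x"])
    show "continuous_on U (\<lambda>x. f x * g x)"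
      using Suc.prems by (simp add: continuous_on_mult)
    show "Ck_on k n U (\<lambda>x. partial_deriv i f x * g x + partial_deriv i g x * f x)" if "i < n" for i
      using Suc that Ck_on_Suc_imp[OF Suc.prems(1)] Ck_on_Suc_imp[OF Suc.prems(2)]
      by (intro Ck_on_add[OF U]) auto
    show "((\<lambda>s. f (x(i := s)) * g (x(i := s))) has_real_derivative
        partial_deriv i f x * g x + partial_deriv i g x * f x) (at (x i))" if "i < n" "x \<in> U" for i x
      using DERIV_mult[OF Ck_on_SucD[OF Suc.prems(1) that] Ck_on_SucD[OF Suc.prems(2) that]]
      by (simp add: fun_upd_def)
  qed
qed

lemma Ck_on_sum:
  assumes "openin (Euclidean_space n) U" "\<And>i. i \<in> I \<Longrightarrow> Ck_on k n U (f i)"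
  shows "Ck_on k n U (\<lambda>x. \<Sum>i\<in>I. f i x)"
  using assms(2)
proof (induction I rule: infinite_finite_induct)
  case (insert i I)
  then show ?case by (simp add: Ck_on_add[OF assms(1)])
qed (use Ck_on_const[OF assms(1), of k 0] in auto)

lemma Ck_on_local:
  assumes "openin (Euclidean_space n) U"
    and "\<And>u. u \<in> U \<Longrightarrow> \<exists>V\<subseteq>U. openin (Euclidean_space n) V \<and> u \<in> V \<and> Ck_on k n V f"
  shows "Ck_on k n U f"
  using assms(2)
proof (induction k arbitrary: f)
  case 0
  have "\<exists>T. open T \<and> u \<in> T \<and> continuous_on (U \<inter> T) f" if u: "u \<in> U" for u
  proof -
    obtain V where V: "V \<subseteq> U" "openin (Euclidean_space n) V" "u \<in> V" "Ck_on 0 n V f"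
      using 0 u by meson
    then obtain T where T: "open T" "V = topspace (Euclidean_space n) \<inter> T"
      using Euclidean_space_eq openin_open by metis
    have "U \<inter> T = V"
      using V(1) T(2) openin_subset[OF assms(1)] by auto
    then show ?thesis
      using T V by auto
  qed
  then obtain T where T: "\<And>u. u \<in> U \<Longrightarrow> open (T u) \<and> u \<in> T u \<and> continuous_on (U \<inter> T u) f"
    by metis
  have "continuous (at u within U) f" if u: "u \<in> U" for u
  proof -
    have "at u within U = at u within (U \<inter> T u)"
      by (rule at_within_nhd[of u "T u"]) (use T[OF u] in auto)
    then show ?thesis
      using T[OF u] u by (simp add: continuous_on_eq_continuous_within)
  qed
  then show ?case by (simp add: continuous_on_eq_continuous_within)
next
  case (Suc k)
  have "\<exists>V\<subseteq>U. openin (Euclidean_space n) V \<and> u \<in> V \<and> Ck_on k n V f" if "u \<in> U" for u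
    using Suc.prems[OF that] Ck_on_Suc_imp by blast
  then have "continuous_on U f"
    using Suc.IH Ck_on_cont by blast
  moreover have "(\<lambda>s. f (x(i := s))) field_differentiable at (x i)" if "x \<in> U" "i < n" for x i
    using Suc.prems[OF that(1)] that(2) by auto
  moreover have "Ck_on k n U (partial_deriv i f)" if "i < n" for i
    using Suc.prems that by (intro Suc.IH) (metis Ck_on.simps(2))
  ultimately show ?case by simp
qed

lemma mvt_two_sided:
  fixes \<phi> :: "real \<Rightarrow> real"
  assumes D: "\<And>s. \<bar>s - a\<bar> \<le> \<bar>b - a\<bar> \<Longrightarrow> (\<phi> has_real_derivative \<phi>' s) (at s)"
  shows "\<exists>s. \<bar>s - a\<bar> \<le> \<bar>b - a\<bar> \<and> \<phi> b - \<phi> a = \<phi>' s * (b - a)"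
proof (cases a b rule: linorder_cases)
  case less
  have "\<exists>z>a. z < b \<and> \<phi> b - \<phi> a = (b - a) * \<phi>' z"
    using less by (intro MVT2 D) auto
  then obtain z where "z > a" "z < b" "\<phi> b - \<phi> a = (b - a) * \<phi>' z" by blast
  then show ?thesis by (intro exI[of _ z]) (auto simp: algebra_simps)
next
  case greater
  have "\<exists>z>b. z < a \<and> \<phi> a - \<phi> b = (a - b) * \<phi>' z"
    using greater by (intro MVT2 D) auto
  then obtain z where "z > b" "z < a" "\<phi> a - \<phi> b = (a - b) * \<phi>' z" by blast
  then show ?thesis by (intro exI[of _ z]) (auto simp: algebra_simps)
qed auto

lemma has_real_derivative_along_curve:
  fixes f :: "(nat \<Rightarrow> real) \<Rightarrow> real" and \<gamma> :: "real \<Rightarrow> nat \<Rightarrow> real"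
  assumes U: "openin (Euclidean_space n) U"
    and D: "\<And>i x. i < n \<Longrightarrow> x \<in> U \<Longrightarrow> ((\<lambda>s. f (x(i := s))) has_real_derivative G i x) (at (x i))"
    and G: "\<And>i. i < n \<Longrightarrow> continuous_on U (G i)"
    and \<gamma>: "\<forall>\<^sub>F t in nhds t0. \<gamma> t \<in> U"
    and c: "\<And>i. i < n \<Longrightarrow> ((\<lambda>t. \<gamma> t i) has_real_derivative c i) (at t0)"
  shows "((\<lambda>t. f (\<gamma> t)) has_real_derivative (\<Sum>i<n. G i (\<gamma> t0) * c i)) (at t0)"
proof -
  define a where "a = \<gamma> t0"
  have a: "a \<in> U" using eventually_nhds_x_imp_x[OF \<gamma>] by (simp add: a_def)
  define \<sigma> where "\<sigma> i t = (\<lambda>k. if k < i then \<gamma> t k else a k)" for i t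
  have near: "\<forall>\<^sub>F t in nhds t0. \<forall>i<n. \<bar>\<gamma> t i - a i\<bar> < \<delta>" if "\<delta> > 0" for \<delta>
  proof -
    have "\<forall>\<^sub>F t in nhds t0. \<bar>\<gamma> t i - a i\<bar> < \<delta>" if "i < n" for i
    proof -
      have "((\<lambda>t. \<gamma> t i) \<longlongrightarrow> a i) (nhds t0)"
        using DERIV_isCont[OF c[OF that]] tendsto_at_iff_tendsto_nhds[of "\<lambda>t. \<gamma> t i" t0]
        by (simp add: isCont_def a_def)
      from tendstoD[OF this \<open>\<delta> > 0\<close>] show ?thesis by (simp add: dist_real_def)
    qed
    then have "\<forall>\<^sub>F t in nhds t0. \<forall>i\<in>{..<n}. \<bar>\<gamma> t i - a i\<bar> < \<delta>"
      by (subst eventually_ball_finite_distrib) auto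
    then show ?thesis by (rule eventually_mono) auto
  qed
  have step: "((\<lambda>t. f (\<sigma> (Suc i) t) - f (\<sigma> i t)) has_real_derivative G i a * c i) (at t0)"
    if i: "i < n" for i
  proof -
    define q where "q t = (if \<gamma> t i = a i then G i a
      else (f (\<sigma> (Suc i) t) - f (\<sigma> i t)) / (\<gamma> t i - a i))" for t
    have eq: "f (\<sigma> (Suc i) t) - f (\<sigma> i t) = q t * (\<gamma> t i - a i)" for t
    proof (cases "\<gamma> t i = a i")
      case True
      then have "\<sigma> (Suc i) t = \<sigma> i t" by (auto simp: \<sigma>_def less_Suc_eq)
      then show ?thesis using True by simp
    qed (simp add: q_def)
    have "\<forall>\<^sub>F t in nhds t0. \<bar>q t - G i a\<bar> < e" if e: "e > 0" for e
    proof -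
      obtain \<delta> where \<delta>: "\<delta> > 0" "\<And>x. x \<in> topspace (Euclidean_space n) \<Longrightarrow>
          (\<forall>i<n. \<bar>x i - a i\<bar> < \<delta>) \<Longrightarrow> x \<in> U \<and> \<bar>G i x - G i a\<bar> < e"
        using continuous_on_Euclidean_box[OF U G[OF i] a e] by blast
      have "\<bar>q t - G i a\<bar> < e" if t: "\<forall>i<n. \<bar>\<gamma> t i - a i\<bar> < \<delta>" "\<gamma> t \<in> U" for t
      proof (cases "\<gamma> t i = a i")
        case False
        define x where "x s = (\<sigma> i t)(i := s)" for s
        have x: "x s \<in> U \<and> \<bar>G i (x s) - G i a\<bar> < e" if "\<bar>s - a i\<bar> \<le> \<bar>\<gamma> t i - a i\<bar>" for s
        proof (rule \<delta>(2))
          show "x s \<in> topspace (Euclidean_space n)"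
            using i openin_Euclidean_subset[OF U a] openin_Euclidean_subset[OF U t(2)]
            by (auto simp: topspace_Euclidean_space x_def \<sigma>_def)
          have "\<bar>s - a i\<bar> < \<delta>" using that t(1) i by force
          then show "\<forall>j<n. \<bar>x s j - a j\<bar> < \<delta>"
            using t(1) \<delta>(1) by (auto simp: x_def \<sigma>_def)
        qed
        have "((\<lambda>s. f (x s)) has_real_derivative G i (x s)) (at s)"
          if "\<bar>s - a i\<bar> \<le> \<bar>\<gamma> t i - a i\<bar>" for s
          using D[OF i conjunct1[OF x[OF that]]] by (simp add: x_def)
        from mvt_two_sided[of "a i" "\<gamma> t i" "\<lambda>s. f (x s)" "\<lambda>s. G i (x s)", OF this]
        obtain s where s: "\<bar>s - a i\<bar> \<le> \<bar>\<gamma> t i - a i\<bar>"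
          "f (x (\<gamma> t i)) - f (x (a i)) = G i (x s) * (\<gamma> t i - a i)"
          by auto
        have "x (\<gamma> t i) = \<sigma> (Suc i) t" "x (a i) = \<sigma> i t"
          by (auto simp: x_def \<sigma>_def less_Suc_eq)
        then have "q t = G i (x s)"
          using s(2) False by (simp add: q_def)
        then show ?thesis using x[OF s(1)] by simp
      qed (use e in \<open>simp add: q_def\<close>)
      then show ?thesis
        using eventually_conj[OF near[OF \<delta>(1)] \<gamma>] by (auto elim: eventually_mono)
    qed
    then have "(q \<longlongrightarrow> G i a) (nhds t0)"
      by (auto simp: tendsto_iff dist_real_def)
    then have "(q \<longlongrightarrow> G i a) (at t0)"
      by (rule tendsto_mono[rotated]) (simp add: at_within_def)
    moreover have "((\<lambda>t. (\<gamma> t i - a i) / (t - t0)) \<longlongrightarrow> c i) (at t0)"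
      using c[OF i] by (simp add: has_field_derivative_iff a_def)
    ultimately have "((\<lambda>t. q t * ((\<gamma> t i - a i) / (t - t0))) \<longlongrightarrow> G i a * c i) (at t0)"
      by (rule tendsto_mult)
    then show ?thesis
      by (simp add: has_field_derivative_iff eq a_def)
  qed
  have "((\<lambda>t. \<Sum>i<n. f (\<sigma> (Suc i) t) - f (\<sigma> i t)) has_real_derivative (\<Sum>i<n. G i a * c i)) (at t0)"
    by (rule DERIV_sum) (use step in simp)
  moreover have "(\<Sum>i<n. f (\<sigma> (Suc i) t) - f (\<sigma> i t)) = f (\<sigma> n t) - f a" for t
    using sum_lessThan_telescope[of "\<lambda>i. f (\<sigma> i t)" n] by (simp add: \<sigma>_def)
  ultimately have "((\<lambda>t. f (\<sigma> n t) - f a) has_real_derivative (\<Sum>i<n. G i a * c i)) (at t0)"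
    by simp
  then have "((\<lambda>t. (f (\<sigma> n t) - f a) + f a) has_real_derivative (\<Sum>i<n. G i a * c i) + 0) (at t0)"
    by (intro DERIV_add DERIV_const)
  then have *: "((\<lambda>t. f (\<sigma> n t)) has_real_derivative (\<Sum>i<n. G i a * c i)) (at t0)"
    by simp
  have "\<forall>\<^sub>F t in nhds t0. f (\<sigma> n t) = f (\<gamma> t)"
    using \<gamma>
  proof eventually_elim
    case (elim t)
    have "\<sigma> n t = \<gamma> t"
      using openin_Euclidean_subset[OF U a] openin_Euclidean_subset[OF U elim]
      by (auto simp: \<sigma>_def fun_eq_iff)
    then show ?case by simp
  qed
  from DERIV_cong_ev[OF refl this refl] show ?thesis
    using * by (simp add: a_def)
qed

lemma continuous_on_compose_Euclidean:
  assumes U: "openin (Euclidean_space n) U" and h: "h \<in> V \<rightarrow> U"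
    and "continuous_on U f" "\<And>i. i < n \<Longrightarrow> continuous_on V (\<lambda>x. h x i)"
  shows "continuous_on V (\<lambda>x. f (h x))"
proof (rule continuous_on_compose2[OF assms(3)])
  have "continuous_on V (\<lambda>x. h x i)" for i
  proof (cases "i < n")
    case False
    then have "x \<in> V \<Longrightarrow> h x i = 0" for x
      using h openin_Euclidean_subset[OF U, of "h x" i] by auto
    then show ?thesis by (auto cong: continuous_on_cong)
  qed (use assms in auto)
  then show "continuous_on V h" by (rule continuous_on_coordinatewise_then_product)
qed (use h in auto)

lemma Ck_on_compose:
  assumes U: "openin (Euclidean_space n) U" and V: "openin (Euclidean_space m) V"
    and h: "h \<in> V \<rightarrow> U"
  shows "Ck_on k n U f \<Longrightarrow> (\<And>i. i < n \<Longrightarrow> Ck_on k m V (\<lambda>x. h x i)) \<Longrightarrow> Ck_on k m V (\<lambda>x. f (h x))"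
proof (induction k arbitrary: f)
  case (Suc k)
  note hk = Suc.prems(2)
  show ?case
  proof (rule Ck_on_SucI[OF V, where G = "\<lambda>j x. \<Sum>i<n. partial_deriv i f (h x) * partial_deriv j (\<lambda>x. h x i) x"])
    show "continuous_on V (\<lambda>x. f (h x))"
      by (rule continuous_on_compose_Euclidean[OF U h Ck_on_cont[OF Suc.prems(1)] Ck_on_cont[OF hk]])
  next
    fix j x assume j: "j < m" and x: "x \<in> V"
    have "((\<lambda>s. f (h (x(j := s)))) has_real_derivative
        (\<Sum>i<n. partial_deriv i f (h (x(j := x j))) * partial_deriv j (\<lambda>x. h x i) x)) (at (x j))"
    proof (rule has_real_derivative_along_curve[OF U])
      show "\<forall>\<^sub>F s in nhds (x j). h (x(j := s)) \<in> U"
        using eventually_line[OF V x j] by eventually_elim (use h in auto)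
      show "continuous_on U (partial_deriv i f)" if "i < n" for i
        using Suc.prems(1) that Ck_on_cont[of k n U "partial_deriv i f"] by simp
      show "((\<lambda>s. f (y(i := s))) has_real_derivative partial_deriv i f y) (at (y i))"
        if "i < n" "y \<in> U" for i y
        by (rule Ck_on_SucD[OF Suc.prems(1) that])
      show "((\<lambda>s. h (x(j := s)) i) has_real_derivative partial_deriv j (\<lambda>x. h x i) x) (at (x j))"
        if "i < n" for i
        by (rule Ck_on_SucD[OF hk[OF that] j x])
    qed
    then show "((\<lambda>s. f (h (x(j := s)))) has_real_derivative
        (\<Sum>i<n. partial_deriv i f (h x) * partial_deriv j (\<lambda>x. h x i) x)) (at (x j))" by simp
  next
    fix j assume j: "j < m"
    show "Ck_on k m V (\<lambda>x. \<Sum>i<n. partial_deriv i f (h x) * partial_deriv j (\<lambda>x. h x i) x)"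
    proof (rule Ck_on_sum[OF V], rule Ck_on_mult[OF V])
      fix i assume i: "i \<in> {..<n}"
      show "Ck_on k m V (\<lambda>x. partial_deriv i f (h x))"
        using Suc.IH[of "partial_deriv i f"] Suc.prems(1) Ck_on_Suc_imp[OF hk] i by simp
      show "Ck_on k m V (partial_deriv j (\<lambda>x. h x i))"
        using hk[of i] i j by simp
    qed
  qed
next
  case 0
  then show ?case
    using continuous_on_compose_Euclidean[OF U h] by simp
qed


section \<open>Diffeological spaces and smooth maps\<close>

text \<open>
  \<open>P n U p\<close> says that the function \<open>p\<close> on the open subset \<open>U\<close> of \<open>n\<close>-space is a plot. The second
  condition only reflects that plots are functions on \<open>U\<close>, represented by total functions.
\<close>

definition is_diffeology ::
    "'a set \<Rightarrow> (nat \<Rightarrow> (nat \<Rightarrow> real) set \<Rightarrow> ((nat \<Rightarrow> real) \<Rightarrow> 'a) \<Rightarrow> bool) \<Rightarrow> bool" where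
  "is_diffeology X P \<longleftrightarrow>
     (\<forall>n U p. P n U p \<longrightarrow> openin (Euclidean_space n) U \<and> p \<in> U \<rightarrow> X) \<and>
     (\<forall>n U p q. P n U p \<and> (\<forall>u\<in>U. p u = q u) \<longrightarrow> P n U q) \<and>
     (\<forall>n U c. openin (Euclidean_space n) U \<and> c \<in> X \<longrightarrow> P n U (\<lambda>u. c)) \<and>
     (\<forall>n U p m V h. P n U p \<and> openin (Euclidean_space m) V \<and> h \<in> V \<rightarrow> U \<and>
        (\<forall>i<n. smooth_on m V (\<lambda>v. h v i)) \<longrightarrow> P m V (\<lambda>v. p (h v))) \<and>
     (\<forall>n U p. openin (Euclidean_space n) U \<and>
        (\<forall>u\<in>U. \<exists>V\<subseteq>U. openin (Euclidean_space n) V \<and> u \<in> V \<and> P n V p) \<longrightarrow> P n U p)"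

typedef 'a diffeology =
  "{(X :: 'a set, P :: nat \<Rightarrow> (nat \<Rightarrow> real) set \<Rightarrow> ((nat \<Rightarrow> real) \<Rightarrow> 'a) \<Rightarrow> bool). is_diffeology X P}"
  by (rule exI[of _ "(UNIV, \<lambda>n U p. openin (Euclidean_space n) U)"]) (auto simp: is_diffeology_def)

definition dspace :: "'a diffeology \<Rightarrow> 'a set" where
  "dspace D = fst (Rep_diffeology D)"

definition plot :: "'a diffeology \<Rightarrow> nat \<Rightarrow> (nat \<Rightarrow> real) set \<Rightarrow> ((nat \<Rightarrow> real) \<Rightarrow> 'a) \<Rightarrow> bool" where
  "plot D = snd (Rep_diffeology D)"

definition diffeology :: "'a set \<Rightarrow> (nat \<Rightarrow> (nat \<Rightarrow> real) set \<Rightarrow> ((nat \<Rightarrow> real) \<Rightarrow> 'a) \<Rightarrow> bool) \<Rightarrow> 'a diffeology" where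
  "diffeology X P = Abs_diffeology (X, P)"

definition smooth_map :: "'a diffeology \<Rightarrow> 'b diffeology \<Rightarrow> ('a \<Rightarrow> 'b) \<Rightarrow> bool" where
  "smooth_map D E F \<longleftrightarrow> F \<in> dspace D \<rightarrow> dspace E \<and>
     (\<forall>n U p. plot D n U p \<longrightarrow> plot E n U (\<lambda>u. F (p u)))"

definition real_diffeology :: "real diffeology" where
  "real_diffeology = diffeology UNIV (\<lambda>n U p. openin (Euclidean_space n) U \<and> smooth_on n U p)"

definition subdiffeology :: "'a diffeology \<Rightarrow> 'a set \<Rightarrow> 'a diffeology" where
  "subdiffeology D S = diffeology (dspace D \<inter> S) (\<lambda>n U p. plot D n U p \<and> p \<in> U \<rightarrow> S)"

definition nonneg_real_diffeology :: "real diffeology" where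
  "nonneg_real_diffeology = subdiffeology real_diffeology {0..}"

text \<open>
  For \<open>U\<close> in \<open>n\<close>-space, \<open>times_real n U\<close> is \<open>U \<times> \<real>\<close> as a subset of \<open>Suc n\<close>-space: the point \<open>(u, x)\<close>
  is the sequence \<open>v\<close> with \<open>u = v(n := 0)\<close> and \<open>x = v n\<close>.
\<close>

definition times_real :: "nat \<Rightarrow> (nat \<Rightarrow> real) set \<Rightarrow> (nat \<Rightarrow> real) set" where
  "times_real n U = {v \<in> topspace (Euclidean_space (Suc n)). v(n := 0) \<in> U}"

definition smooth_nonneg_funs :: "(real \<Rightarrow> real) set" where
  "smooth_nonneg_funs = {f. smooth_real_fun f \<and> (\<forall>x. 0 \<le> f x)}"

definition smooth_nonneg_diffeology :: "(real \<Rightarrow> real) diffeology" where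
  "smooth_nonneg_diffeology = diffeology smooth_nonneg_funs
     (\<lambda>n U p. openin (Euclidean_space n) U \<and> p \<in> U \<rightarrow> smooth_nonneg_funs \<and>
        smooth_on (Suc n) (times_real n U) (\<lambda>v. p (v(n := 0)) (v n)))"


section \<open>The constructions above are diffeologies\<close>

lemma is_diffeology_Rep: "is_diffeology (dspace D) (plot D)"
  using Rep_diffeology[of D] by (auto simp: dspace_def plot_def)

lemma plot_openin: "plot D n U p \<Longrightarrow> openin (Euclidean_space n) U"
  and plot_range: "plot D n U p \<Longrightarrow> p \<in> U \<rightarrow> dspace D"
  using conjunct1[OF is_diffeology_Rep[of D, unfolded is_diffeology_def], rule_format, of n U p]
  by simp_all

lemma plot_cong: "plot D n U p \<Longrightarrow> (\<And>u. u \<in> U \<Longrightarrow> p u = q u) \<Longrightarrow> plot D n U q"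
  using conjunct1[OF conjunct2[OF is_diffeology_Rep[of D, unfolded is_diffeology_def]],
      rule_format, of n U p q]
  by simp

lemma plot_const: "openin (Euclidean_space n) U \<Longrightarrow> c \<in> dspace D \<Longrightarrow> plot D n U (\<lambda>u. c)"
  using conjunct1[OF conjunct2[OF conjunct2[OF is_diffeology_Rep[of D, unfolded is_diffeology_def]]],
      rule_format, of n U c]
  by simp

lemma plot_compose:
  assumes "plot D n U p" "openin (Euclidean_space m) V" "h \<in> V \<rightarrow> U"
    and "\<And>i. i < n \<Longrightarrow> smooth_on m V (\<lambda>v. h v i)"
  shows "plot D m V (\<lambda>v. p (h v))"
  using conjunct1[OF conjunct2[OF conjunct2[OF conjunct2[OF
      is_diffeology_Rep[of D, unfolded is_diffeology_def]]]], rule_format, of n U p m V h] assms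
  by simp

lemma plot_local:
  assumes "openin (Euclidean_space n) U"
    and "\<And>u. u \<in> U \<Longrightarrow> \<exists>V\<subseteq>U. openin (Euclidean_space n) V \<and> u \<in> V \<and> plot D n V p"
  shows "plot D n U p"
  using conjunct2[OF conjunct2[OF conjunct2[OF conjunct2[OF
      is_diffeology_Rep[of D, unfolded is_diffeology_def]]]], rule_format, of n U p] assms
  by simp

lemma
  assumes "is_diffeology X P"
  shows dspace_diffeology: "dspace (diffeology X P) = X"
    and plot_diffeology: "plot (diffeology X P) = P"
  using assms by (simp_all add: dspace_def plot_def diffeology_def Abs_diffeology_inverse)

lemma smooth_on_compose:
  assumes "openin (Euclidean_space n) U" "openin (Euclidean_space m) V" "h \<in> V \<rightarrow> U"
    and "smooth_on n U f" "\<And>i. i < n \<Longrightarrow> smooth_on m V (\<lambda>x. h x i)"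
  shows "smooth_on m V (\<lambda>x. f (h x))"
  using Ck_on_compose[OF assms(1-3), of _ f] assms(4,5) by (simp add: smooth_on_def)

lemma smooth_on_cong:
  assumes "openin (Euclidean_space n) U" "smooth_on n U f" "\<And>x. x \<in> U \<Longrightarrow> f x = g x"
  shows "smooth_on n U g"
  using assms Ck_on_cong[of n U _ f g] by (auto simp: smooth_on_def)

lemma smooth_on_local:
  assumes "openin (Euclidean_space n) U"
    and "\<And>u. u \<in> U \<Longrightarrow> \<exists>V\<subseteq>U. openin (Euclidean_space n) V \<and> u \<in> V \<and> smooth_on n V f"
  shows "smooth_on n U f"
  unfolding smooth_on_def
proof
  fix k
  show "Ck_on k n U f"
  proof (rule Ck_on_local[OF assms(1)])
    show "\<exists>V\<subseteq>U. openin (Euclidean_space n) V \<and> u \<in> V \<and> Ck_on k n V f" if "u \<in> U" for u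
      using assms(2)[OF that] unfolding smooth_on_def by metis
  qed
qed

lemma is_diffeology_real:
  "is_diffeology UNIV (\<lambda>n U p. openin (Euclidean_space n) U \<and> smooth_on n U (p :: _ \<Rightarrow> real))"
  unfolding is_diffeology_def
proof (intro conjI allI impI)
  fix n U and p :: "_ \<Rightarrow> real"
  assume *: "openin (Euclidean_space n) U \<and> (\<forall>u\<in>U. \<exists>V\<subseteq>U. openin (Euclidean_space n) V \<and>
    u \<in> V \<and> openin (Euclidean_space n) V \<and> smooth_on n V p)"
  show "smooth_on n U p"
    by (rule smooth_on_local) (use * in blast)+
next
  fix n U and p q :: "_ \<Rightarrow> real"
  assume "(openin (Euclidean_space n) U \<and> smooth_on n U p) \<and> (\<forall>u\<in>U. p u = q u)"
  then show "smooth_on n U q" using smooth_on_cong[of n U p q] by blast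
next
  fix n U p m V and h :: "(nat \<Rightarrow> real) \<Rightarrow> nat \<Rightarrow> real"
  assume "(openin (Euclidean_space n) U \<and> smooth_on n U (p :: _ \<Rightarrow> real)) \<and>
    openin (Euclidean_space m) V \<and> h \<in> V \<rightarrow> U \<and> (\<forall>i<n. smooth_on m V (\<lambda>v. h v i))"
  then show "smooth_on m V (\<lambda>v. p (h v))" using smooth_on_compose[of n U m V h p] by blast
qed (auto simp: smooth_on_def Ck_on_const)

lemma dspace_real_diffeology [simp]: "dspace real_diffeology = UNIV"
  and plot_real_diffeology [simp]:
    "plot real_diffeology n U p \<longleftrightarrow> openin (Euclidean_space n) U \<and> smooth_on n U p"
  unfolding real_diffeology_def
  by (simp_all add: dspace_diffeology[OF is_diffeology_real] plot_diffeology[OF is_diffeology_real])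

lemma is_diffeology_sub:
  "is_diffeology (dspace D \<inter> S) (\<lambda>n U p. plot D n U p \<and> p \<in> U \<rightarrow> S)"
  unfolding is_diffeology_def
proof (intro conjI allI impI)
  fix n U p q assume *: "(plot D n U p \<and> p \<in> U \<rightarrow> S) \<and> (\<forall>u\<in>U. p u = q u)"
  then show "plot D n U q" by (metis plot_cong)
  show "q \<in> U \<rightarrow> S" using * by (metis Pi_cong)
next
  fix n U p m V and h :: "(nat \<Rightarrow> real) \<Rightarrow> nat \<Rightarrow> real"
  assume *: "(plot D n U p \<and> p \<in> U \<rightarrow> S) \<and> openin (Euclidean_space m) V \<and> h \<in> V \<rightarrow> U \<and>
    (\<forall>i<n. smooth_on m V (\<lambda>v. h v i))"
  then show "plot D m V (\<lambda>v. p (h v))" using plot_compose[of D n U p m V h] by blast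
  show "(\<lambda>v. p (h v)) \<in> V \<rightarrow> S" using * by blast
next
  fix n U p
  assume *: "openin (Euclidean_space n) U \<and> (\<forall>u\<in>U. \<exists>V\<subseteq>U. openin (Euclidean_space n) V \<and>
    u \<in> V \<and> plot D n V p \<and> p \<in> V \<rightarrow> S)"
  then show "plot D n U p" using plot_local[of n U D p] by blast
  show "p \<in> U \<rightarrow> S" using * by blast
next
  fix n U p assume "plot D n U p \<and> p \<in> U \<rightarrow> S"
  then show "openin (Euclidean_space n) U" "p \<in> U \<rightarrow> dspace D \<inter> S"
    using plot_openin[of D n U p] plot_range[of D n U p] by blast+
next
  fix n U c assume "openin (Euclidean_space n) U \<and> c \<in> dspace D \<inter> S"
  then show "plot D n U (\<lambda>u. c)" "(\<lambda>u. c) \<in> U \<rightarrow> S"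
    using plot_const[of n U c D] by blast+
qed

lemma dspace_subdiffeology [simp]: "dspace (subdiffeology D S) = dspace D \<inter> S"
  and plot_subdiffeology [simp]: "plot (subdiffeology D S) n U p \<longleftrightarrow> plot D n U p \<and> p \<in> U \<rightarrow> S"
  unfolding subdiffeology_def
  by (simp_all add: dspace_diffeology[OF is_diffeology_sub] plot_diffeology[OF is_diffeology_sub])

lemma openin_times_real:
  assumes "openin (Euclidean_space n) U"
  shows "openin (Euclidean_space (Suc n)) (times_real n U)"
  unfolding times_real_def
proof (rule openin_continuous_map_preimage[OF _ assms])
  have "continuous_map (Euclidean_space (Suc n)) euclideanreal (\<lambda>v. v i)" for i
    unfolding Euclidean_space_def
    by (intro continuous_map_from_subtopology continuous_map_product_projection) simp
  then have "continuous_map (Euclidean_space (Suc n)) (Euclidean_space n) (\<lambda>v i. if i < n then v i else 0)"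
    by (simp add: continuous_map_componentwise_Euclidean_space)
  then show "continuous_map (Euclidean_space (Suc n)) (Euclidean_space n) (\<lambda>v. v(n := 0))"
    by (rule continuous_map_eq) (auto simp: topspace_Euclidean_space fun_eq_iff)
qed

lemma Ck_on_real_fun:
  assumes U: "openin (Euclidean_space n) U"
  shows "smooth_real_fun f \<Longrightarrow> Ck_on k n U (\<lambda>v. f (v i))"
proof (induction k arbitrary: f)
  case (Suc k)
  have f: "(f has_real_derivative deriv f x) (at x)" for x
    using Suc.prems unfolding smooth_real_fun_def DERIV_deriv_iff_field_differentiable
    by (metis funpow_0)
  have "smooth_real_fun (deriv f)"
    unfolding smooth_real_fun_def
  proof (intro allI)
    fix k x
    show "(deriv ^^ k) (deriv f) field_differentiable at x"
      using Suc.prems[unfolded smooth_real_fun_def, rule_format, of "Suc k" x]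
      by (simp only: funpow_Suc_right o_apply)
  qed
  then have "Ck_on k n U (\<lambda>v. deriv f (v i))" by (rule Suc.IH)
  then have *: "Ck_on k n U (\<lambda>v. if j = i then deriv f (v i) else 0)" for j
    using Ck_on_const[OF U] by (cases "j = i") simp_all
  have "continuous_on UNIV f"
    using f by (meson DERIV_isCont continuous_at_imp_continuous_on)
  then have "continuous_on U (\<lambda>v. f (v i))"
    using Ck_on_coord[OF U, of 0 i] by (auto intro: continuous_on_compose2)
  then show ?case
  proof (rule Ck_on_SucI[OF U _ _ *])
    show "((\<lambda>s. f ((x(j := s)) i)) has_real_derivative (if j = i then deriv f (x i) else 0)) (at (x j))" for j x
      by (cases "j = i") (simp_all add: f)
  qed
next
  case 0
  have "continuous_on UNIV f"
    using 0 unfolding smooth_real_fun_def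
    by (metis continuous_at_imp_continuous_on field_differentiable_imp_continuous_at funpow_0)
  then show ?case
    using Ck_on_coord[OF U, of 0 i] by (auto intro: continuous_on_compose2)
qed

lemma is_diffeology_smooth_nonneg:
  "is_diffeology smooth_nonneg_funs
     (\<lambda>n U p. openin (Euclidean_space n) U \<and> p \<in> U \<rightarrow> smooth_nonneg_funs \<and>
        smooth_on (Suc n) (times_real n U) (\<lambda>v. p (v(n := 0)) (v n)))"
  unfolding is_diffeology_def
proof (intro conjI allI impI)
  fix n U and p q :: "(nat \<Rightarrow> real) \<Rightarrow> real \<Rightarrow> real"
  assume *: "(openin (Euclidean_space n) U \<and> p \<in> U \<rightarrow> smooth_nonneg_funs \<and>
      smooth_on (Suc n) (times_real n U) (\<lambda>v. p (v(n := 0)) (v n))) \<and> (\<forall>u\<in>U. p u = q u)"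
  show "smooth_on (Suc n) (times_real n U) (\<lambda>v. q (v(n := 0)) (v n))"
    by (rule smooth_on_cong[of _ _ "\<lambda>v. p (v(n := 0)) (v n)"])
       (use * openin_times_real in \<open>auto simp: times_real_def\<close>)
  show "q \<in> U \<rightarrow> smooth_nonneg_funs"
  proof
    fix u assume "u \<in> U"
    then have "p u \<in> smooth_nonneg_funs" using * funcset_mem by blast
    moreover have "p u = q u" using * \<open>u \<in> U\<close> by blast
    ultimately show "q u \<in> smooth_nonneg_funs" by simp
  qed
next
  fix n U and c :: "real \<Rightarrow> real"
  assume "openin (Euclidean_space n) U \<and> c \<in> smooth_nonneg_funs"
  then show "smooth_on (Suc n) (times_real n U) (\<lambda>v. c (v n))"
    by (auto simp: smooth_nonneg_funs_def smooth_on_def intro: Ck_on_real_fun openin_times_real)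
next
  fix n U and p :: "(nat \<Rightarrow> real) \<Rightarrow> real \<Rightarrow> real" and m V and h :: "(nat \<Rightarrow> real) \<Rightarrow> nat \<Rightarrow> real"
  assume *: "(openin (Euclidean_space n) U \<and> p \<in> U \<rightarrow> smooth_nonneg_funs \<and>
      smooth_on (Suc n) (times_real n U) (\<lambda>v. p (v(n := 0)) (v n))) \<and>
      openin (Euclidean_space m) V \<and> h \<in> V \<rightarrow> U \<and> (\<forall>i<n. smooth_on m V (\<lambda>v. h v i))"
  then have U: "openin (Euclidean_space n) U" and V: "openin (Euclidean_space m) V"
    and h: "h \<in> V \<rightarrow> U" and hs: "\<And>i. i < n \<Longrightarrow> smooth_on m V (\<lambda>v. h v i)"
    and p: "smooth_on (Suc n) (times_real n U) (\<lambda>v. p (v(n := 0)) (v n))" by auto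
  define H where "H v = (h (v(m := 0)))(n := v m)" for v
  have hn: "(h (v(m := 0)))(n := 0) = h (v(m := 0))" if "v \<in> times_real m V" for v
  proof -
    have "h (v(m := 0)) \<in> U" using that h by (auto simp: times_real_def)
    then show ?thesis using openin_Euclidean_subset[OF U, of "h (v(m := 0))" n] by auto
  qed
  have "smooth_on (Suc m) (times_real m V) (\<lambda>v. p ((H v)(n := 0)) (H v n))"
  proof (rule smooth_on_compose[OF openin_times_real[OF U] openin_times_real[OF V] _ p])
    have "H v \<in> times_real n U" if v: "v \<in> times_real m V" for v
    proof -
      have "h (v(m := 0)) \<in> U" using v h by (auto simp: times_real_def)
      then show ?thesis
        using openin_Euclidean_subset[OF U, of "h (v(m := 0))"] hn[OF v]
        by (auto simp: times_real_def H_def topspace_Euclidean_space)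
    qed
    then show "H \<in> times_real m V \<rightarrow> times_real n U" by blast
    show "smooth_on (Suc m) (times_real m V) (\<lambda>v. H v i)" if "i < Suc n" for i
    proof (cases "i = n")
      case True
      then show ?thesis
        using Ck_on_coord[OF openin_times_real[OF V]] by (simp add: H_def smooth_on_def)
    next
      case False
      then have "smooth_on m V (\<lambda>v. h v i)" using that hs by simp
      then have "smooth_on (Suc m) (times_real m V) (\<lambda>v. h (v(m := 0)) i)"
        using Ck_on_coord[OF openin_times_real[OF V]]
        by (intro smooth_on_compose[OF V openin_times_real[OF V], of "\<lambda>v. v(m := 0)" "\<lambda>v. h v i"])
           (auto simp: times_real_def smooth_on_def)
      then show ?thesis using False by (simp add: H_def)
    qed
  qed
  then show "smooth_on (Suc m) (times_real m V) (\<lambda>v. p (h (v(m := 0))) (v m))"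
    by (rule smooth_on_cong[OF openin_times_real[OF V]]) (simp add: H_def hn)
next
  fix n U and p :: "(nat \<Rightarrow> real) \<Rightarrow> real \<Rightarrow> real"
  assume *: "openin (Euclidean_space n) U \<and> (\<forall>u\<in>U. \<exists>V\<subseteq>U. openin (Euclidean_space n) V \<and>
    u \<in> V \<and> openin (Euclidean_space n) V \<and> p \<in> V \<rightarrow> smooth_nonneg_funs \<and>
    smooth_on (Suc n) (times_real n V) (\<lambda>v. p (v(n := 0)) (v n)))"
  show "p \<in> U \<rightarrow> smooth_nonneg_funs"
    using * by blast
  show "smooth_on (Suc n) (times_real n U) (\<lambda>v. p (v(n := 0)) (v n))"
  proof (rule smooth_on_local)
    fix v assume v: "v \<in> times_real n U"
    then obtain V where V: "V \<subseteq> U" "openin (Euclidean_space n) V" "v(n := 0) \<in> V"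
      "smooth_on (Suc n) (times_real n V) (\<lambda>v. p (v(n := 0)) (v n))"
      using * unfolding times_real_def by blast
    then show "\<exists>W\<subseteq>times_real n U. openin (Euclidean_space (Suc n)) W \<and> v \<in> W \<and>
        smooth_on (Suc n) W (\<lambda>v. p (v(n := 0)) (v n))"
      using v openin_times_real by (intro exI[of _ "times_real n V"]) (auto simp: times_real_def)
  qed (use * openin_times_real in blast)
qed auto

lemma dspace_smooth_nonneg_diffeology [simp]: "dspace smooth_nonneg_diffeology = smooth_nonneg_funs"
  and plot_smooth_nonneg_diffeology [simp]:
    "plot smooth_nonneg_diffeology n U p \<longleftrightarrow>
       openin (Euclidean_space n) U \<and> p \<in> U \<rightarrow> smooth_nonneg_funs \<and>
       smooth_on (Suc n) (times_real n U) (\<lambda>v. p (v(n := 0)) (v n))"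
  unfolding smooth_nonneg_diffeology_def
  by (simp_all add: dspace_diffeology[OF is_diffeology_smooth_nonneg]
        plot_diffeology[OF is_diffeology_smooth_nonneg])

end

theory Submission
  imports Defs
begin

text \<open>
  The map is \<open>F f = exp (- \<integral>\<^sub>0\<^sup>1 1 / f\<^sup>2)\<close>, with \<open>F f = 0\<close> if \<open>f\<close> has a zero in \<open>[0, 1]\<close>. Only smoothness
  needs proof. A plot is a smooth family \<open>g (u, x) \<ge> 0\<close>; write \<open>J u = \<integral>\<^sub>0\<^sup>1 dx / g (u, x)\<^sup>2\<close> for the
  parameters \<open>u\<close> at which \<open>g (u, \<sqdot>)\<close> is positive on \<open>[0, 1]\<close>. These form an open set, on which \<open>F\<close> is
  smooth by differentiation under the integral sign. The issue is what happens as \<open>u\<close> approaches a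
  parameter \<open>u0\<close> such that \<open>g (u0, x0) = 0\<close>.

  Every derivative of \<open>exp (- J)\<close> is \<open>exp (- J)\<close> times a sum of products of integrals
  \<open>\<integral>\<^sub>0\<^sup>1 h / g\<^sup>N\<close> with \<open>h\<close> smooth. Near \<open>u0\<close> these integrals are bounded by powers of \<open>1 / min g\<close>, so
  the exponential wins as soon as \<open>J\<close> is at least a constant times \<open>1 / min g\<close>. That is the content of
  \<open>inverse_le_integral_inverse_square\<close>: if \<open>0 < \<phi> \<le> B\<close> and \<open>\<bar>\<phi>'\<bar> \<le> B\<close>, then \<open>1 / \<phi>\<close> has a derivative
  bounded by \<open>B / \<phi>\<^sup>2\<close> and so oscillates by at most \<open>B \<integral> 1 / \<phi>\<^sup>2\<close>. The square in the definition of \<open>F\<close>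
  makes this elementary bound sufficient.

  Consequently every function \<open>a exp (- J)\<close> with such a coefficient \<open>a\<close>, extended by \<open>0\<close>, is
  \<open>O(g (u, x0)\<^sup>2)\<close> near \<open>u0\<close> (\<open>flat_ext_bound\<close>). Hence it is continuous there with vanishing partial
  derivatives, and its partial derivatives are of the same form. A class of continuous functions that
  is closed under partial derivatives consists of smooth functions (\<open>smooth_on_coinduct\<close>).
\<close>

section \<open>Real analysis\<close>

lemma has_real_derivative_zero_if_dominated:
  fixes f q :: "real \<Rightarrow> real"
  assumes dom: "\<forall>\<^sub>F s in at t. \<bar>f s\<bar> \<le> q s" and "f t = 0" "q t = 0"
    and q: "(q has_real_derivative 0) (at t)"
  shows "(f has_real_derivative 0) (at t)"
proof -
  have "((\<lambda>s. (q s - q t) / (s - t)) \<longlongrightarrow> 0) (at t)"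
    using q by (simp add: has_field_derivative_iff)
  moreover have "\<forall>\<^sub>F s in at t. norm ((f s - f t) / (s - t)) \<le> norm ((q s - q t) / (s - t)) * 1"
    using dom
  proof eventually_elim
    case (elim s)
    then show ?case
      by (auto simp: assms abs_divide intro!: divide_right_mono)
  qed
  ultimately show ?thesis
    unfolding has_field_derivative_iff by (rule tendsto_0_le)
qed

text \<open>
  The shift to \<open>1 + t\<close> makes powers monotone in the exponent, so that bounds with different exponents
  can be added.
\<close>
lemma power_mult_exp_minus_le:
  fixes t :: real
  assumes t: "t \<ge> 0" and M: "M > 0"
  shows "(1 + t) ^ M * exp (- t) \<le> real M ^ M"
proof -
  have "1 + t \<le> real M * (1 + t / real M)"
    using M by (simp add: field_simps)
  then have "(1 + t) ^ M \<le> (real M * (1 + t / real M)) ^ M"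
    using t by (intro power_mono) auto
  also have "\<dots> = real M ^ M * (1 + t / real M) ^ M"
    by (rule power_mult_distrib)
  also have "\<dots> \<le> real M ^ M * exp t"
    using M t exp_ge_one_plus_x_over_n_power_n[of M t]
    by (intro mult_left_mono) auto
  finally show ?thesis
    by (simp add: exp_minus field_simps)
qed

text \<open>
  As \<open>(1 / \<phi>)' = - \<phi>' / \<phi>\<^sup>2\<close>, the values of \<open>1 / \<phi>\<close> at two points differ by at most
  \<open>B \<integral> 1 / \<phi>\<^sup>2\<close>. Averaging over the second point \<open>y\<close>, where \<open>1 / \<phi> y \<le> B / (\<phi> y)\<^sup>2\<close>, gives another
  \<open>B \<integral> 1 / \<phi>\<^sup>2\<close>.
\<close>
lemma inverse_le_integral_inverse_square:
  fixes \<phi> \<phi>' :: "real \<Rightarrow> real"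
  assumes D: "\<And>x. x \<in> {0..1} \<Longrightarrow> (\<phi> has_real_derivative \<phi>' x) (at x)"
    and pos: "\<And>x. x \<in> {0..1} \<Longrightarrow> 0 < \<phi> x"
    and bd: "\<And>x. x \<in> {0..1} \<Longrightarrow> \<phi> x \<le> B" "\<And>x. x \<in> {0..1} \<Longrightarrow> \<bar>\<phi>' x\<bar> \<le> B"
    and x0: "x0 \<in> {0..1}"
  shows "1 / \<phi> x0 \<le> 2 * B * integral {0..1} (\<lambda>x. 1 / (\<phi> x)\<^sup>2)"
proof -
  define J where "J = integral {0..1} (\<lambda>x. 1 / (\<phi> x)\<^sup>2)"
  have cont: "continuous_on {0..1} \<phi>"
    using D by (meson DERIV_isCont continuous_at_imp_continuous_on)
  have nz: "x \<in> {0..1} \<Longrightarrow> \<phi> x \<noteq> 0" for x using pos[of x] by auto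
  have cont2: "continuous_on {0..1} (\<lambda>x. 1 / (\<phi> x)\<^sup>2)"
    using nz by (intro continuous_intros cont) auto
  have int: "(\<lambda>x. 1 / (\<phi> x)\<^sup>2) integrable_on {a..b}" if "{a..b} \<subseteq> {0..1}" for a b
    by (rule integrable_continuous_real, rule continuous_on_subset[OF cont2 that])
  have B: "B \<ge> 0" using pos[OF x0] bd(1)[OF x0] by simp
  have seg: "\<bar>1 / \<phi> b - 1 / \<phi> a\<bar> \<le> B * J" if ab: "a \<le> b" "{a..b} \<subseteq> {0..1}" for a b
  proof -
    have "((\<lambda>x. - \<phi>' x / (\<phi> x)\<^sup>2) has_integral 1 / \<phi> b - 1 / \<phi> a) {a..b}"
    proof (rule fundamental_theorem_of_calculus[OF ab(1)])
      fix x assume "x \<in> {a..b}"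
      then have x: "x \<in> {0..1}" using ab by blast
      have "((\<lambda>x. 1 / \<phi> x) has_real_derivative - \<phi>' x / (\<phi> x)\<^sup>2) (at x)"
        using nz[OF x] by (auto intro!: derivative_eq_intros D x simp: power2_eq_square)
      then show "((\<lambda>x. 1 / \<phi> x) has_vector_derivative - \<phi>' x / (\<phi> x)\<^sup>2) (at x within {a..b})"
        using has_real_derivative_iff_has_vector_derivative has_vector_derivative_at_within by blast
    qed
    then have I: "(\<lambda>x. - \<phi>' x / (\<phi> x)\<^sup>2) integrable_on {a..b}"
      "1 / \<phi> b - 1 / \<phi> a = integral {a..b} (\<lambda>x. - \<phi>' x / (\<phi> x)\<^sup>2)"
      using integral_unique by (blast, metis)
    have "norm (integral {a..b} (\<lambda>x. - \<phi>' x / (\<phi> x)\<^sup>2)) \<le> integral {a..b} (\<lambda>x. B * (1 / (\<phi> x)\<^sup>2))"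
    proof (rule integral_norm_bound_integral[OF I(1)])
      show "(\<lambda>x. B * (1 / (\<phi> x)\<^sup>2)) integrable_on {a..b}"
        using int[OF ab(2)] by (rule integrable_on_mult_right)
      show "norm (- \<phi>' x / (\<phi> x)\<^sup>2) \<le> B * (1 / (\<phi> x)\<^sup>2)" if "x \<in> {a..b}" for x
        using that ab(2) bd(2)[of x] by (auto simp: abs_divide intro!: divide_right_mono)
    qed
    also have "\<dots> = B * integral {a..b} (\<lambda>x. 1 / (\<phi> x)\<^sup>2)"
      by (rule integral_mult_right)
    also have "\<dots> \<le> B * J"
      unfolding J_def using ab(2) B int by (intro mult_left_mono integral_subset_le) auto
    finally show ?thesis using I(2) by simp
  qed
  have diff: "1 / \<phi> x0 \<le> B * (1 / (\<phi> y)\<^sup>2) + B * J" if y: "y \<in> {0..1}" for y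
  proof -
    have "\<bar>1 / \<phi> x0 - 1 / \<phi> y\<bar> \<le> B * J"
      using seg[of x0 y] seg[of y x0] x0 y by (cases "x0 \<le> y") (auto simp: abs_minus_commute)
    moreover have "1 / \<phi> y \<le> B * (1 / (\<phi> y)\<^sup>2)"
      using pos[OF y] bd(1)[OF y] by (simp add: field_simps power2_eq_square)
    ultimately show ?thesis by linarith
  qed
  have "integral {0..1::real} (\<lambda>y. 1 / \<phi> x0) \<le> integral {0..1} (\<lambda>y. B * (1 / (\<phi> y)\<^sup>2) + B * J)"
    using diff int[of 0 1]
    by (intro integral_le integrable_add integrable_on_mult_right) auto
  also have "\<dots> = integral {0..1} (\<lambda>y. B * (1 / (\<phi> y)\<^sup>2)) + integral {0..1::real} (\<lambda>y. B * J)"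
    using int[of 0 1] by (intro integral_add integrable_on_mult_right) auto
  also have "\<dots> = B * J + B * J"
    by (simp only: J_def integral_mult_right) simp
  finally show ?thesis by (simp add: J_def)
qed

section \<open>Smooth functions of finitely many variables\<close>

text \<open>
  The induction on the order of differentiability runs over the whole class \<open>S\<close> at once, so no formula
  for higher derivatives is needed. Continuity has to be assumed because partial differentiability
  does not imply it.
\<close>
lemma smooth_on_coinduct:
  assumes U: "openin (Euclidean_space n) U" and "a \<in> S"
    and cont: "\<And>a. a \<in> S \<Longrightarrow> continuous_on U a"
    and deriv: "\<And>a i. a \<in> S \<Longrightarrow> i < n \<Longrightarrow>
      \<exists>b\<in>S. \<forall>u\<in>U. ((\<lambda>s. a (u(i := s))) has_real_derivative b u) (at (u i))"
  shows "smooth_on n U a"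
  unfolding smooth_on_def
proof
  fix k
  show "Ck_on k n U a"
    using \<open>a \<in> S\<close>
  proof (induction k arbitrary: a)
    case 0
    then show ?case using cont by simp
  next
    case (Suc k)
    obtain b where b: "\<And>i. i < n \<Longrightarrow> b i \<in> S"
      "\<And>i u. i < n \<Longrightarrow> u \<in> U \<Longrightarrow> ((\<lambda>s. a (u(i := s))) has_real_derivative b i u) (at (u i))"
      using deriv[OF Suc.prems] by metis
    show ?case
      by (rule Ck_on_SucI[OF U cont[OF Suc.prems] b(2) Suc.IH[OF b(1)]])
  qed
qed

lemma smooth_on_mult:
  "openin (Euclidean_space n) U \<Longrightarrow> smooth_on n U f \<Longrightarrow> smooth_on n U g \<Longrightarrow> smooth_on n U (\<lambda>x. f x * g x)"
  by (simp add: smooth_on_def Ck_on_mult)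

lemma smooth_on_const: "openin (Euclidean_space n) U \<Longrightarrow> smooth_on n U (\<lambda>x. c)"
  by (simp add: smooth_on_def Ck_on_const)

lemma smooth_on_partial_deriv: "smooth_on n U f \<Longrightarrow> i < n \<Longrightarrow> smooth_on n U (partial_deriv i f)"
  unfolding smooth_on_def by (metis Ck_on.simps(2))

lemma smooth_on_imp_continuous_on: "smooth_on n U f \<Longrightarrow> continuous_on U f"
  unfolding smooth_on_def by (metis Ck_on.simps(1))

lemma smooth_on_has_partial_deriv:
  assumes "smooth_on n U f" "i < n" "x \<in> U"
  shows "((\<lambda>s. f (x(i := s))) has_real_derivative partial_deriv i f x) (at (x i))"
  using Ck_on_SucD[of 0 n U f] assms unfolding smooth_on_def by blast

section \<open>Slices of a function on a product with the real line\<close>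

lemma upd_in_times_real:
  assumes U: "openin (Euclidean_space n) U" and u: "u \<in> U"
  shows "u(n := x) \<in> times_real n U"
proof -
  have "u n = 0" using openin_Euclidean_subset[OF U u] by simp
  then have "u(n := 0) = u" by auto
  then show ?thesis
    using openin_Euclidean_subset[OF U u] u by (auto simp: times_real_def topspace_Euclidean_space)
qed

lemma continuous_on_upd:
  fixes h :: "(nat \<Rightarrow> real) \<Rightarrow> real"
  assumes U: "openin (Euclidean_space n) U" and h: "continuous_on (times_real n U) h"
  shows "continuous_on (U \<times> C) (\<lambda>(u, x). h (u(n := x)))"
proof -
  have "continuous_on (U \<times> C) (\<lambda>p. h ((fst p)(n := snd p)))"
  proof (rule continuous_on_compose2[OF h])
    have "continuous_on (U \<times> C) (\<lambda>p. ((fst p)(n := snd p)) i)" for i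
    proof (cases "i = n")
      case False
      have "continuous_on (U \<times> C) (\<lambda>p. fst p i)"
        by (rule continuous_on_compose2[OF continuous_on_product_coordinates continuous_on_fst])
           (auto intro: continuous_on_id)
      then show ?thesis using False by simp
    qed (simp add: continuous_on_snd)
    then show "continuous_on (U \<times> C) (\<lambda>p. (fst p)(n := snd p))"
      by (rule continuous_on_coordinatewise_then_product)
  qed (use upd_in_times_real[OF U] in auto)
  then show ?thesis by (simp add: split_beta)
qed

lemma continuous_on_fun_upd_value:
  fixes u :: "'a \<Rightarrow> 'b::topological_space"
  shows "continuous_on C (\<lambda>s. u(i := s))"
proof (rule continuous_on_coordinatewise_then_product)
  show "continuous_on C (\<lambda>s. (u(i := s)) j)" for j
    by (cases "j = i") (simp_all add: continuous_on_id)
qed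

lemma continuous_on_slice:
  fixes h :: "(nat \<Rightarrow> real) \<Rightarrow> real"
  assumes U: "openin (Euclidean_space n) U" and h: "continuous_on (times_real n U) h" and u: "u \<in> U"
  shows "continuous_on C (\<lambda>x. h (u(n := x)))"
  by (rule continuous_on_compose2[OF h continuous_on_fun_upd_value]) (use upd_in_times_real[OF U u] in auto)

lemma slices_uniformly_close:
  fixes h :: "(nat \<Rightarrow> real) \<Rightarrow> real"
  assumes U: "openin (Euclidean_space n) U" and h: "continuous_on (times_real n U) h" and u0: "u0 \<in> U"
    and e: "e > 0"
  obtains X where "open X" "u0 \<in> X"
    "\<And>u x. u \<in> X \<inter> U \<Longrightarrow> x \<in> {0..1} \<Longrightarrow> \<bar>h (u(n := x)) - h (u0(n := x))\<bar> \<le> e"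
proof -
  from continuous_on_prod_compactE[OF continuous_on_upd[OF U h, of "{0..1}"] compact_Icc u0 e]
  obtain X where "u0 \<in> X" "open X"
    "\<forall>u\<in>X \<inter> U. \<forall>x\<in>{0..1}. dist (case (u, x) of (u, x) \<Rightarrow> h (u(n := x)))
      (case (u0, x) of (u, x) \<Rightarrow> h (u(n := x))) \<le> e" .
  then show ?thesis
    by (intro that[of X]) (simp_all add: dist_real_def)
qed

lemma eventually_bounded_upd:
  fixes h :: "(nat \<Rightarrow> real) \<Rightarrow> real"
  assumes U: "openin (Euclidean_space n) U" and h: "continuous_on (times_real n U) h" and u0: "u0 \<in> U"
  shows "\<exists>B. \<forall>\<^sub>F u in at u0 within U. \<forall>x\<in>{0..1}. \<bar>h (u(n := x))\<bar> \<le> B"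
proof -
  obtain X where X: "open X" "u0 \<in> X"
    and near: "\<And>u x. u \<in> X \<inter> U \<Longrightarrow> x \<in> {0..1} \<Longrightarrow> \<bar>h (u(n := x)) - h (u0(n := x))\<bar> \<le> 1"
    using slices_uniformly_close[OF U h u0 zero_less_one] by blast
  have "continuous_on {0..1} (\<lambda>x. h (u0(n := x)))"
    by (rule continuous_on_slice[OF U h u0])
  then have "bounded ((\<lambda>x. h (u0(n := x))) ` {0..1})"
    by (intro compact_imp_bounded compact_continuous_image) auto
  then obtain B where B: "\<forall>x\<in>{0..1}. \<bar>h (u0(n := x))\<bar> \<le> B"
    by (auto simp: bounded_iff)
  have "\<forall>x\<in>{0..1}. \<bar>h (u(n := x))\<bar> \<le> B + 1" if "u \<in> X \<inter> U" for u
    using near[OF that] B by fastforce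
  moreover have "\<forall>\<^sub>F u in at u0 within U. u \<in> X \<inter> U"
    using X eventually_at_topological by auto
  ultimately show ?thesis
    by (intro exI[of _ "B + 1"]) (auto elim: eventually_mono)
qed

text \<open>Turns estimates near a point of \<open>U\<close> into estimates along a coordinate line through it.\<close>
lemma filterlim_line_at_within:
  assumes U: "openin (Euclidean_space n) U" and u: "u \<in> U" and i: "i < n"
  shows "filterlim (\<lambda>s. u(i := s)) (at u within U) (at (u i))"
  unfolding filterlim_at
proof
  have "continuous_on UNIV (\<lambda>s. u(i := s))"
    by (rule continuous_on_fun_upd_value)
  then have "((\<lambda>s. u(i := s)) \<longlongrightarrow> u(i := u i)) (at (u i))"
    unfolding continuous_on_def by blast
  then show "((\<lambda>s. u(i := s)) \<longlongrightarrow> u) (at (u i))" unfolding fun_upd_triv .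
  have "\<forall>\<^sub>F s in at (u i). u(i := s) \<in> U"
    using eventually_line[OF U u i] by (auto simp: eventually_at_filter elim: eventually_mono)
  moreover have "\<forall>\<^sub>F s in at (u i). s \<noteq> u i" by (simp add: eventually_at_filter)
  ultimately show "\<forall>\<^sub>F s in at (u i). u(i := s) \<in> U \<and> u(i := s) \<noteq> u"
    by eventually_elim (metis fun_upd_same)
qed

section \<open>The coefficients in the derivatives\<close>

text \<open>
  A plot of non-negative functions, in uncurried form: \<open>g (u(n := x))\<close> is the value at \<open>x\<close> of the
  function with parameter \<open>u\<close>.
\<close>
locale nonneg_family =
  fixes n :: nat and U :: "(nat \<Rightarrow> real) set" and g :: "(nat \<Rightarrow> real) \<Rightarrow> real"
  assumes open_U: "openin (Euclidean_space n) U"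
    and smooth_g: "smooth_on (Suc n) (times_real n U) g"
    and nonneg_g: "\<And>v. v \<in> times_real n U \<Longrightarrow> 0 \<le> g v"
begin

definition pos_set :: "(nat \<Rightarrow> real) set" where
  "pos_set = {u \<in> U. \<forall>x\<in>{0..1}. 0 < g (u(n := x))}"

definition weighted_integral :: "((nat \<Rightarrow> real) \<Rightarrow> real) \<Rightarrow> nat \<Rightarrow> (nat \<Rightarrow> real) \<Rightarrow> real" where
  "weighted_integral h N u = integral {0..1} (\<lambda>x. h (u(n := x)) / g (u(n := x)) ^ N)"

definition energy :: "(nat \<Rightarrow> real) \<Rightarrow> real" where
  "energy = weighted_integral (\<lambda>_. 1) 2"

text \<open>
  The functions \<open>a\<close> for which \<open>a exp (- energy)\<close> occurs as a derivative of \<open>exp (- energy)\<close> all lie in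
  this class. Exponent \<open>0\<close> yields the constants, and with them negation, so two closure rules suffice.
  The members are only meaningful on \<open>pos_set\<close>.
\<close>
inductive coeff :: "((nat \<Rightarrow> real) \<Rightarrow> real) \<Rightarrow> bool" where
  weighted_integral: "smooth_on (Suc n) (times_real n U) h \<Longrightarrow> coeff (weighted_integral h N)"
| add: "coeff a \<Longrightarrow> coeff b \<Longrightarrow> coeff (\<lambda>u. a u + b u)"
| mult: "coeff a \<Longrightarrow> coeff b \<Longrightarrow> coeff (\<lambda>u. a u * b u)"

definition flat_ext :: "((nat \<Rightarrow> real) \<Rightarrow> real) \<Rightarrow> (nat \<Rightarrow> real) \<Rightarrow> real" where
  "flat_ext a u = (if u \<in> pos_set then a u * exp (- energy u) else 0)"

lemmas open_W = openin_times_real[OF open_U]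

lemma coeff_const: "coeff (\<lambda>_. c)"
proof -
  have "coeff (weighted_integral (\<lambda>_. c) 0)" by (intro coeff.weighted_integral smooth_on_const open_W)
  then show ?thesis by (simp add: weighted_integral_def[abs_def])
qed

lemma coeff_energy: "coeff energy"
  unfolding energy_def by (intro coeff.weighted_integral smooth_on_const open_W)

text \<open>By compactness of the unit interval, a positive slice has a positive minimum.\<close>
lemma open_pos_set: "openin (Euclidean_space n) pos_set"
proof (subst openin_subopen, safe)
  fix u0 assume u0: "u0 \<in> pos_set"
  then have u0U: "u0 \<in> U" by (simp add: pos_set_def)
  have "continuous_on {0..1} (\<lambda>x. g (u0(n := x)))"
    by (rule continuous_on_slice[OF open_U smooth_on_imp_continuous_on[OF smooth_g] u0U])
  then obtain y where y: "y \<in> {0..1}" "\<forall>x\<in>{0..1}. g (u0(n := y)) \<le> g (u0(n := x))"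
    using continuous_attains_inf[of "{0..1::real}" "\<lambda>x. g (u0(n := x))"] by auto
  define m where "m = g (u0(n := y))"
  have m: "m > 0" using u0 y(1) by (simp add: pos_set_def m_def)
  obtain X where X: "open X" "u0 \<in> X"
    and near: "\<And>u x. u \<in> X \<inter> U \<Longrightarrow> x \<in> {0..1} \<Longrightarrow> \<bar>g (u(n := x)) - g (u0(n := x))\<bar> \<le> m / 2"
    using slices_uniformly_close[OF open_U smooth_on_imp_continuous_on[OF smooth_g] u0U half_gt_zero[OF m]]
    by blast
  have "u \<in> pos_set" if u: "u \<in> U \<inter> X" for u
  proof -
    have "0 < g (u(n := x))" if x: "x \<in> {0..1}" for x
    proof -
      have "\<bar>g (u(n := x)) - g (u0(n := x))\<bar> \<le> m / 2"
        using near[of u x] u x by blast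
      moreover have "m \<le> g (u0(n := x))" using y(2) x by (simp add: m_def)
      ultimately show ?thesis using m by linarith
    qed
    then show ?thesis using u by (simp add: pos_set_def)
  qed
  moreover have "openin (Euclidean_space n) (U \<inter> X)"
    using openin_trans[OF openin_open_Int[OF X(1)]] open_U Euclidean_space_eq by metis
  ultimately show "\<exists>T. openin (Euclidean_space n) T \<and> u0 \<in> T \<and> T \<subseteq> pos_set"
    using X(2) u0U by blast
qed

lemma continuous_on_weighted:
  assumes "continuous_on (times_real n U) h"
  shows "continuous_on (pos_set \<times> {0..1}) (\<lambda>(u, x). h (u(n := x)) / g (u(n := x)) ^ N)"
proof -
  have sub: "pos_set \<times> {0..1} \<subseteq> U \<times> {0..1}" by (auto simp: pos_set_def)
  have "continuous_on (pos_set \<times> {0..1}) (\<lambda>p. h ((fst p)(n := snd p)) / g ((fst p)(n := snd p)) ^ N)"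
    using continuous_on_subset[OF continuous_on_upd[OF open_U assms] sub]
      continuous_on_subset[OF continuous_on_upd[OF open_U smooth_on_imp_continuous_on[OF smooth_g]] sub]
    by (intro continuous_intros) (auto simp: split_beta pos_set_def)
  then show ?thesis by (simp add: split_beta)
qed

lemma integrable_weighted:
  assumes "continuous_on (times_real n U) h" "u \<in> pos_set"
  shows "(\<lambda>x. h (u(n := x)) / g (u(n := x)) ^ N) integrable_on {0..1}"
proof (rule integrable_continuous_real)
  show "continuous_on {0..1} (\<lambda>x. h (u(n := x)) / g (u(n := x)) ^ N)"
    using assms(2) unfolding pos_set_def
    by (intro continuous_intros continuous_on_slice[OF open_U] assms(1)
          smooth_on_imp_continuous_on[OF smooth_g]) force+
qed

lemma continuous_on_weighted_integral:
  assumes "continuous_on (times_real n U) h"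
  shows "continuous_on pos_set (weighted_integral h N)"
  using integral_continuous_on_param[of pos_set 0 "1::real" "\<lambda>u x. h (u(n := x)) / g (u(n := x)) ^ N"]
    continuous_on_weighted[OF assms]
  unfolding weighted_integral_def[abs_def] by simp

text \<open>Differentiation under the integral sign and the quotient rule for \<open>h / g\<^sup>N\<close>.\<close>
lemma has_partial_derivative_weighted_integral:
  assumes h: "smooth_on (Suc n) (times_real n U) h" and i: "i < n" and u: "u \<in> pos_set"
  shows "((\<lambda>s. weighted_integral h N (u(i := s))) has_real_derivative
    weighted_integral (partial_deriv i h) N u + weighted_integral (\<lambda>v. - real N * (h v * partial_deriv i g v)) (Suc N) u) (at (u i))"
proof -
  define h' where "h' = (\<lambda>v. - real N * (h v * partial_deriv i g v))"
  have ch: "continuous_on (times_real n U) (partial_deriv i h)"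
    using i smooth_on_imp_continuous_on[OF smooth_on_partial_deriv[OF h]] by simp
  have "smooth_on (Suc n) (times_real n U) h'"
    unfolding h'_def using i h smooth_g
    by (intro smooth_on_mult smooth_on_const smooth_on_partial_deriv open_W) auto
  then have ch': "continuous_on (times_real n U) h'"
    by (rule smooth_on_imp_continuous_on)
  obtain e where e: "e > 0" "\<And>s. s \<in> ball (u i) e \<Longrightarrow> u(i := s) \<in> pos_set"
    using eventually_line[OF open_pos_set u i] unfolding eventually_nhds_metric
    by (auto simp: dist_commute)
  let ?G = "\<lambda>s x. partial_deriv i h (u(i := s, n := x)) / g (u(i := s, n := x)) ^ N
    + h' (u(i := s, n := x)) / g (u(i := s, n := x)) ^ Suc N"
  have "((\<lambda>s. integral (cbox 0 1) (\<lambda>x. h (u(i := s, n := x)) / g (u(i := s, n := x)) ^ N))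
    has_real_derivative integral (cbox 0 1) (?G (u i))) (at (u i) within ball (u i) e)"
  proof (rule leibniz_rule_field_derivative)
    fix s x :: real assume s: "s \<in> ball (u i) e" and x: "x \<in> cbox 0 1"
    define v where "v = u(i := s, n := x)"
    have v: "v \<in> times_real n U" "g v > 0"
      using e(2)[OF s] x upd_in_times_real[OF open_U] by (auto simp: pos_set_def v_def)
    have vi: "v i = s" "v(i := s') = u(i := s', n := x)" for s'
      using i by (auto simp: v_def fun_upd_twist)
    have Dh: "((\<lambda>s. h (u(i := s, n := x))) has_real_derivative partial_deriv i h v) (at s)"
      using smooth_on_has_partial_deriv[OF h _ v(1), of i] i unfolding vi by simp
    have Dg: "((\<lambda>s. g (u(i := s, n := x))) has_real_derivative partial_deriv i g v) (at s)"
      using smooth_on_has_partial_deriv[OF smooth_g _ v(1), of i] i unfolding vi by simp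
    have "((\<lambda>s. h (u(i := s, n := x)) / g (u(i := s, n := x)) ^ N) has_real_derivative
      partial_deriv i h v / g v ^ N + h' v / g v ^ Suc N) (at s)"
    proof (rule DERIV_cong[OF DERIV_divide[OF Dh DERIV_power[OF Dg]]])
      show "g (u(i := s, n := x)) ^ N \<noteq> 0"
        using v(2) by (simp add: v_def)
      show "(partial_deriv i h v * g (u(i := s, n := x)) ^ N
          - h (u(i := s, n := x)) * (real N * (partial_deriv i g v * g (u(i := s, n := x)) ^ (N - Suc 0))))
          / (g (u(i := s, n := x)) ^ N * g (u(i := s, n := x)) ^ N)
        = partial_deriv i h v / g v ^ N + h' v / g v ^ Suc N"
        unfolding v_def[symmetric] h'_def using v(2) by (cases N) (simp_all add: field_simps)
    qed
    then show "((\<lambda>s. h (u(i := s, n := x)) / g (u(i := s, n := x)) ^ N) has_real_derivative ?G s x)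
        (at s within ball (u i) e)"
      unfolding v_def by (rule has_field_derivative_at_within)
  next
    show "(\<lambda>x. h (u(i := s, n := x)) / g (u(i := s, n := x)) ^ N) integrable_on cbox 0 1"
      if "s \<in> ball (u i) e" for s
      using integrable_weighted[OF smooth_on_imp_continuous_on[OF h] e(2)[OF that]] by simp
    have "continuous_on (ball (u i) e \<times> {0..1}) (\<lambda>p. (u(i := fst p), snd p :: real))"
      by (intro continuous_on_Pair continuous_on_snd continuous_on_id
            continuous_on_compose2[OF continuous_on_fun_upd_value[of UNIV u i]] continuous_on_fst) auto
    from continuous_on_compose2[OF continuous_on_weighted this]
    have c: "continuous_on (ball (u i) e \<times> {0..1})
        (\<lambda>p. k (u(i := fst p, n := snd p)) / g (u(i := fst p, n := snd p)) ^ M)"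
      if "continuous_on (times_real n U) k" for k M
      using that e(2) by fastforce
    show "continuous_on (ball (u i) e \<times> cbox 0 1) (\<lambda>(s, x). ?G s x)"
      unfolding split_beta using continuous_on_add[OF c[OF ch, of N] c[OF ch', of "Suc N"]] by simp
  qed (use e(1) in auto)
  moreover have "integral (cbox 0 1) (?G (u i)) = weighted_integral (partial_deriv i h) N u + weighted_integral h' (Suc N) u"
    unfolding weighted_integral_def
    using integral_add[OF integrable_weighted[OF ch u, of N] integrable_weighted[OF ch' u, of "Suc N"]] by simp
  ultimately show ?thesis
    using e(1) at_within_open[of "u i" "ball (u i) e"] unfolding weighted_integral_def h'_def by simp
qed

lemma continuous_on_coeff: "coeff a \<Longrightarrow> continuous_on pos_set a"
  by (induction rule: coeff.induct)
     (auto intro: continuous_on_weighted_integral smooth_on_imp_continuous_on continuous_intros)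

lemma coeff_has_partial_derivative:
  assumes "coeff a" and i: "i < n"
  shows "\<exists>b. coeff b \<and> (\<forall>u\<in>pos_set. ((\<lambda>s. a (u(i := s))) has_real_derivative b u) (at (u i)))"
  using assms(1)
proof (induction rule: coeff.induct)
  case (weighted_integral h N)
  have "coeff (\<lambda>u. weighted_integral (partial_deriv i h) N u + weighted_integral (\<lambda>v. - real N * (h v * partial_deriv i g v)) (Suc N) u)"
    using weighted_integral i smooth_g
    by (intro coeff.intros smooth_on_mult smooth_on_const smooth_on_partial_deriv open_W) auto
  then show ?case
    using has_partial_derivative_weighted_integral[OF weighted_integral i] by blast
next
  case (add a b)
  then obtain a' b' where *: "coeff a'" "coeff b'"
    "\<And>u. u \<in> pos_set \<Longrightarrow> ((\<lambda>s. a (u(i := s))) has_real_derivative a' u) (at (u i))"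
    "\<And>u. u \<in> pos_set \<Longrightarrow> ((\<lambda>s. b (u(i := s))) has_real_derivative b' u) (at (u i))" by blast
  have "((\<lambda>s. a (u(i := s)) + b (u(i := s))) has_real_derivative a' u + b' u) (at (u i))"
    if "u \<in> pos_set" for u
    by (rule DERIV_add[OF *(3,4)[OF that]])
  then show ?case
    using coeff.add[OF *(1,2)] by blast
next
  case (mult a b)
  then obtain a' b' where *: "coeff a'" "coeff b'"
    "\<And>u. u \<in> pos_set \<Longrightarrow> ((\<lambda>s. a (u(i := s))) has_real_derivative a' u) (at (u i))"
    "\<And>u. u \<in> pos_set \<Longrightarrow> ((\<lambda>s. b (u(i := s))) has_real_derivative b' u) (at (u i))" by blast
  have "((\<lambda>s. a (u(i := s)) * b (u(i := s))) has_real_derivative a' u * b u + b' u * a u) (at (u i))"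
    if "u \<in> pos_set" for u
    using DERIV_mult[OF *(3,4)[OF that]] by simp
  moreover have "coeff (\<lambda>u. a' u * b u + b' u * a u)"
    using * mult.hyps by (intro coeff.add coeff.mult)
  ultimately show ?case by blast
qed

lemma energy_nonneg: "u \<in> pos_set \<Longrightarrow> 0 \<le> energy u"
  unfolding energy_def weighted_integral_def
  by (rule integral_nonneg) (use integrable_weighted[of "\<lambda>_. 1"] in auto)

section \<open>Flatness at parameters with a zero\<close>

text \<open>
  The constant \<open>K\<close> works uniformly near \<open>u0\<close>, although \<open>g\<close> may tend to \<open>0\<close> there, because it depends
  only on local bounds for \<open>g\<close> and its derivative in the last variable.
\<close>
lemma inverse_le_energy:
  assumes u0: "u0 \<in> U"
  shows "\<exists>K>0. \<forall>\<^sub>F u in at u0 within U. u \<in> pos_set \<longrightarrow> (\<forall>x\<in>{0..1}. 1 / g (u(n := x)) \<le> K * energy u)"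
proof -
  have "continuous_on (times_real n U) (partial_deriv n g)"
    by (intro smooth_on_imp_continuous_on[OF smooth_on_partial_deriv[OF smooth_g]]) simp
  then obtain B1 where B1: "\<forall>\<^sub>F u in at u0 within U. \<forall>x\<in>{0..1}. \<bar>partial_deriv n g (u(n := x))\<bar> \<le> B1"
    using eventually_bounded_upd[OF open_U _ u0] by blast
  obtain B2 where B2: "\<forall>\<^sub>F u in at u0 within U. \<forall>x\<in>{0..1}. \<bar>g (u(n := x))\<bar> \<le> B2"
    using eventually_bounded_upd[OF open_U smooth_on_imp_continuous_on[OF smooth_g] u0] by blast
  define B where "B = max 1 (max B1 B2)"
  have "\<forall>\<^sub>F u in at u0 within U. u \<in> pos_set \<longrightarrow> (\<forall>x\<in>{0..1}. 1 / g (u(n := x)) \<le> 2 * B * energy u)"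
    using B1 B2
  proof eventually_elim
    case (elim u)
    show ?case
    proof (intro impI ballI)
      fix x :: real assume u: "u \<in> pos_set" and x: "x \<in> {0..1}"
      have "1 / g (u(n := x)) \<le> 2 * B * integral {0..1} (\<lambda>x. 1 / (g (u(n := x)))\<^sup>2)"
      proof (rule inverse_le_integral_inverse_square[OF _ _ _ _ x])
        fix y :: real assume y: "y \<in> {0..1}"
        have "u(n := y) \<in> times_real n U"
          using u upd_in_times_real[OF open_U] by (simp add: pos_set_def)
        from smooth_on_has_partial_deriv[OF smooth_g _ this, of n]
        show "((\<lambda>x. g (u(n := x))) has_real_derivative partial_deriv n g (u(n := y))) (at y)" by simp
        show "0 < g (u(n := y))" using u y by (simp add: pos_set_def)
        show "g (u(n := y)) \<le> B" "\<bar>partial_deriv n g (u(n := y))\<bar> \<le> B"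
          using elim[THEN bspec, OF y] by (auto simp: B_def)
      qed
      then show "1 / g (u(n := x)) \<le> 2 * B * energy u" by (simp add: energy_def weighted_integral_def)
    qed
  qed
  moreover have "2 * B > 0" by (simp add: B_def)
  ultimately show ?thesis by blast
qed

text \<open>
  Bounding coefficients by powers of the energy, rather than of the minimum of a slice, gives a bound
  that can be compared directly with \<open>exp (- energy)\<close>.
\<close>
lemma coeff_bound:
  assumes "coeff a" and u0: "u0 \<in> U"
  shows "\<exists>C N. \<forall>\<^sub>F u in at u0 within U. u \<in> pos_set \<longrightarrow> \<bar>a u\<bar> \<le> C * (1 + energy u) ^ N"
  using assms(1)
proof (induction rule: coeff.induct)
  case (weighted_integral h N)
  obtain K where K: "K > 0"
    "\<forall>\<^sub>F u in at u0 within U. u \<in> pos_set \<longrightarrow> (\<forall>x\<in>{0..1}. 1 / g (u(n := x)) \<le> K * energy u)"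
    using inverse_le_energy[OF u0] by blast
  obtain B where B: "\<forall>\<^sub>F u in at u0 within U. \<forall>x\<in>{0..1}. \<bar>h (u(n := x))\<bar> \<le> B"
    using eventually_bounded_upd[OF open_U smooth_on_imp_continuous_on[OF weighted_integral] u0] by blast
  have "\<forall>\<^sub>F u in at u0 within U. u \<in> pos_set \<longrightarrow> \<bar>weighted_integral h N u\<bar> \<le> (B * K ^ N) * (1 + energy u) ^ N"
    using K(2) B
  proof eventually_elim
    case (elim u)
    show ?case
    proof
      assume u: "u \<in> pos_set"
      define M where "M = B * (K * energy u) ^ N"
      have B0: "B \<ge> 0" using elim(2)[THEN bspec, of 0] by auto
      have "norm (weighted_integral h N u) \<le> integral {0..1::real} (\<lambda>x. M)"
        unfolding weighted_integral_def
      proof (rule integral_norm_bound_integral)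
        show "(\<lambda>x. h (u(n := x)) / g (u(n := x)) ^ N) integrable_on {0..1}"
          by (rule integrable_weighted[OF smooth_on_imp_continuous_on[OF weighted_integral] u])
        fix x :: real assume x: "x \<in> {0..1}"
        have pos: "g (u(n := x)) > 0" using u x by (simp add: pos_set_def)
        have "norm (h (u(n := x)) / g (u(n := x)) ^ N) = \<bar>h (u(n := x))\<bar> * (1 / g (u(n := x))) ^ N"
          using pos by (simp add: abs_divide power_divide)
        also have "\<dots> \<le> M"
          unfolding M_def using elim u x pos B0 by (intro mult_mono power_mono) auto
        finally show "norm (h (u(n := x)) / g (u(n := x)) ^ N) \<le> M" .
      qed auto
      also have "\<dots> = B * K ^ N * energy u ^ N"
        by (simp add: M_def power_mult_distrib)
      also have "\<dots> \<le> B * K ^ N * (1 + energy u) ^ N"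
        using B0 K(1) energy_nonneg[OF u] by (intro mult_left_mono power_mono) auto
      finally show "\<bar>weighted_integral h N u\<bar> \<le> (B * K ^ N) * (1 + energy u) ^ N" by simp
    qed
  qed
  then show ?case by blast
next
  case (add a b)
  then obtain C N C' N' where
    a: "\<forall>\<^sub>F u in at u0 within U. u \<in> pos_set \<longrightarrow> \<bar>a u\<bar> \<le> C * (1 + energy u) ^ N" and
    b: "\<forall>\<^sub>F u in at u0 within U. u \<in> pos_set \<longrightarrow> \<bar>b u\<bar> \<le> C' * (1 + energy u) ^ N'" by blast
  have "\<forall>\<^sub>F u in at u0 within U. u \<in> pos_set \<longrightarrow> \<bar>a u + b u\<bar> \<le> (\<bar>C\<bar> + \<bar>C'\<bar>) * (1 + energy u) ^ (N + N')"
    using a b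
  proof eventually_elim
    case (elim u)
    show ?case
    proof
      assume u: "u \<in> pos_set"
      note e = energy_nonneg[OF u]
      have "\<bar>a u\<bar> \<le> C * (1 + energy u) ^ N" using elim u by simp
      also have "\<dots> \<le> \<bar>C\<bar> * (1 + energy u) ^ (N + N')"
        using e by (intro mult_mono power_increasing) auto
      finally have 1: "\<bar>a u\<bar> \<le> \<bar>C\<bar> * (1 + energy u) ^ (N + N')" .
      have "\<bar>b u\<bar> \<le> C' * (1 + energy u) ^ N'" using elim u by simp
      also have "\<dots> \<le> \<bar>C'\<bar> * (1 + energy u) ^ (N + N')"
        using e by (intro mult_mono power_increasing) auto
      finally show "\<bar>a u + b u\<bar> \<le> (\<bar>C\<bar> + \<bar>C'\<bar>) * (1 + energy u) ^ (N + N')"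
        using 1 by (simp add: distrib_right)
    qed
  qed
  then show ?case by blast
next
  case (mult a b)
  then obtain C N C' N' where
    a: "\<forall>\<^sub>F u in at u0 within U. u \<in> pos_set \<longrightarrow> \<bar>a u\<bar> \<le> C * (1 + energy u) ^ N" and
    b: "\<forall>\<^sub>F u in at u0 within U. u \<in> pos_set \<longrightarrow> \<bar>b u\<bar> \<le> C' * (1 + energy u) ^ N'" by blast
  have "\<forall>\<^sub>F u in at u0 within U. u \<in> pos_set \<longrightarrow> \<bar>a u * b u\<bar> \<le> (C * C') * (1 + energy u) ^ (N + N')"
    using a b
  proof eventually_elim
    case (elim u)
    show ?case
    proof
      assume u: "u \<in> pos_set"
      have "\<bar>a u\<bar> * \<bar>b u\<bar> \<le> (C * (1 + energy u) ^ N) * (C' * (1 + energy u) ^ N')"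
        using elim u by (intro mult_mono) (auto intro: order_trans[OF abs_ge_zero])
      then show "\<bar>a u * b u\<bar> \<le> (C * C') * (1 + energy u) ^ (N + N')"
        by (simp add: abs_mult power_add mult_ac)
    qed
  qed
  then show ?case by blast
qed

text \<open>
  By \<open>inverse_le_energy\<close>, \<open>1 \<le> (1 + energy)\<^sup>2 (K g)\<^sup>2\<close>; inserting this factor costs two more powers of
  the energy, which the exponential absorbs. At a zero \<open>x0\<close> of the slice at \<open>u0\<close>, the bound
  vanishes to second order along every coordinate line through \<open>u0\<close>.
\<close>
lemma flat_ext_bound:
  assumes "coeff a" and u0: "u0 \<in> U" and x0: "x0 \<in> {0..1}"
  shows "\<exists>C. \<forall>\<^sub>F u in at u0 within U. \<bar>flat_ext a u\<bar> \<le> C * (g (u(n := x0)))\<^sup>2"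
proof -
  obtain C N where C: "\<forall>\<^sub>F u in at u0 within U. u \<in> pos_set \<longrightarrow> \<bar>a u\<bar> \<le> C * (1 + energy u) ^ N"
    using coeff_bound[OF assms(1) u0] by blast
  obtain K where K: "K > 0"
    "\<forall>\<^sub>F u in at u0 within U. u \<in> pos_set \<longrightarrow> (\<forall>x\<in>{0..1}. 1 / g (u(n := x)) \<le> K * energy u)"
    using inverse_le_energy[OF u0] by blast
  define D where "D = \<bar>C\<bar> * real (N + 2) ^ (N + 2) * K\<^sup>2"
  have "\<forall>\<^sub>F u in at u0 within U. \<bar>flat_ext a u\<bar> \<le> D * (g (u(n := x0)))\<^sup>2"
    using C K(2)
  proof eventually_elim
    case (elim u)
    show ?case
    proof (cases "u \<in> pos_set")
      case u: True
      define E where "E = energy u"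
      have E: "E \<ge> 0" using energy_nonneg[OF u] by (simp add: E_def)
      have pos: "g (u(n := x0)) > 0" using u x0 by (simp add: pos_set_def)
      have "1 / g (u(n := x0)) \<le> K * E"
        using elim(2) u x0 by (simp add: E_def)
      then have "1 \<le> K * E * g (u(n := x0))"
        using pos by (simp add: pos_divide_le_eq)
      also have "\<dots> \<le> (1 + E) * (K * g (u(n := x0)))"
        using K(1) pos by (simp add: algebra_simps)
      finally have "1\<^sup>2 \<le> ((1 + E) * (K * g (u(n := x0))))\<^sup>2"
        by (intro power_mono) auto
      then have one: "1 \<le> (1 + E)\<^sup>2 * (K * g (u(n := x0)))\<^sup>2"
        by (simp only: power_mult_distrib power_one)
      have "\<bar>flat_ext a u\<bar> = \<bar>a u\<bar> * exp (- E)"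
        using u by (simp add: flat_ext_def abs_mult E_def)
      also have "\<dots> \<le> (\<bar>C\<bar> * (1 + E) ^ N) * exp (- E)"
      proof (rule mult_right_mono)
        have "\<bar>a u\<bar> \<le> C * (1 + E) ^ N" using elim(1) u by (simp add: E_def)
        also have "\<dots> \<le> \<bar>C\<bar> * (1 + E) ^ N" using E by (intro mult_right_mono) auto
        finally show "\<bar>a u\<bar> \<le> \<bar>C\<bar> * (1 + E) ^ N" .
      qed simp
      also have "\<dots> \<le> (\<bar>C\<bar> * (1 + E) ^ N) * exp (- E) * ((1 + E)\<^sup>2 * (K * g (u(n := x0)))\<^sup>2)"
        using mult_left_mono[OF one, of "(\<bar>C\<bar> * (1 + E) ^ N) * exp (- E)"] E by simp
      also have "\<dots> = \<bar>C\<bar> * (K * g (u(n := x0)))\<^sup>2 * ((1 + E) ^ (N + 2) * exp (- E))"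
        by (simp only: power_add mult_ac)
      also have "\<dots> \<le> \<bar>C\<bar> * (K * g (u(n := x0)))\<^sup>2 * real (N + 2) ^ (N + 2)"
        by (intro mult_left_mono power_mult_exp_minus_le E) auto
      also have "\<dots> = D * (g (u(n := x0)))\<^sup>2"
        by (simp only: D_def power_mult_distrib mult_ac)
      finally show ?thesis .
    qed (auto simp: flat_ext_def D_def)
  qed
  then show ?thesis by blast
qed

lemma zero_if_not_pos:
  assumes "u \<in> U" "u \<notin> pos_set"
  obtains x where "x \<in> {0..1}" "g (u(n := x)) = 0"
  using assms nonneg_g[OF upd_in_times_real[OF open_U assms(1)]] that
  unfolding pos_set_def by (force simp: order_less_le)

lemma continuous_on_flat_ext:
  assumes a: "coeff a"
  shows "continuous_on U (flat_ext a)"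
  unfolding continuous_on_eq_continuous_within
proof
  fix u0 assume u0: "u0 \<in> U"
  show "continuous (at u0 within U) (flat_ext a)"
  proof (cases "u0 \<in> pos_set")
    case True
    obtain T where T: "open T" "pos_set = topspace (Euclidean_space n) \<inter> T"
      using open_pos_set Euclidean_space_eq openin_open by metis
    have "U \<inter> T = pos_set"
      using T(2) openin_subset[OF open_U] by (auto simp: pos_set_def)
    then have at: "at u0 within U = at u0 within pos_set"
      using at_within_nhd[of u0 T U pos_set] T True by auto
    have "continuous_on pos_set (\<lambda>u. a u * exp (- energy u))"
      by (intro continuous_intros continuous_on_coeff a coeff_energy)
    then have "continuous_on pos_set (flat_ext a)"
      by (rule continuous_on_eq) (simp add: flat_ext_def)
    then show ?thesis
      using True by (simp add: at continuous_on_eq_continuous_within)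
  next
    case False
    then obtain x0 where x0: "x0 \<in> {0..1}" "g (u0(n := x0)) = 0"
      using zero_if_not_pos[OF u0] by blast
    obtain C where C: "\<forall>\<^sub>F u in at u0 within U. \<bar>flat_ext a u\<bar> \<le> C * (g (u(n := x0)))\<^sup>2"
      using flat_ext_bound[OF a u0 x0(1)] by blast
    have "continuous_on U (\<lambda>u. g (u(n := x0)))"
      using continuous_on_compose2[OF continuous_on_upd[OF open_U smooth_on_imp_continuous_on[OF smooth_g], of UNIV]
          continuous_on_Pair[OF continuous_on_id continuous_on_const[of U x0]]]
      by (simp add: image_subset_iff)
    then have "((\<lambda>u. g (u(n := x0))) \<longlongrightarrow> 0) (at u0 within U)"
      using u0 x0(2) by (auto simp: continuous_on_def)
    then have "((\<lambda>u. C * (g (u(n := x0)))\<^sup>2) \<longlongrightarrow> C * 0\<^sup>2) (at u0 within U)"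
      by (intro tendsto_intros)
    then have "((\<lambda>u. C * (g (u(n := x0)))\<^sup>2) \<longlongrightarrow> 0) (at u0 within U)" by simp
    then have "(flat_ext a \<longlongrightarrow> 0) (at u0 within U)"
      by (rule Lim_null_comparison[rotated]) (use C in simp)
    then show ?thesis
      using False by (simp add: continuous_within flat_ext_def)
  qed
qed

text \<open>
  On \<open>pos_set\<close> this is the product rule. Elsewhere \<open>flat_ext b\<close> is \<open>0\<close>, which is the right value by
  \<open>flat_ext_bound\<close>: the square of a differentiable function has derivative \<open>0\<close> at its zeros.
\<close>
lemma flat_ext_has_partial_derivative:
  assumes a: "coeff a" and i: "i < n"
  shows "\<exists>b. coeff b \<and> (\<forall>u\<in>U. ((\<lambda>s. flat_ext a (u(i := s))) has_real_derivative flat_ext b u) (at (u i)))"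
proof -
  obtain a' where a': "coeff a'"
    "\<And>u. u \<in> pos_set \<Longrightarrow> ((\<lambda>s. a (u(i := s))) has_real_derivative a' u) (at (u i))"
    using coeff_has_partial_derivative[OF a i] by blast
  obtain e' where e': "coeff e'"
    "\<And>u. u \<in> pos_set \<Longrightarrow> ((\<lambda>s. energy (u(i := s))) has_real_derivative e' u) (at (u i))"
    using coeff_has_partial_derivative[OF coeff_energy i] by blast
  define b where "b u = a' u + (-1) * (a u * e' u)" for u
  have "coeff b"
    unfolding b_def[abs_def] by (intro coeff.add coeff.mult coeff_const a a' e')
  moreover have "((\<lambda>s. flat_ext a (u(i := s))) has_real_derivative flat_ext b u) (at (u i))" if u: "u \<in> U" for u
  proof (cases "u \<in> pos_set")
    case True
    have "((\<lambda>s. a (u(i := s)) * exp (- energy (u(i := s)))) has_real_derivative flat_ext b u) (at (u i))"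
      using True by (auto intro!: derivative_eq_intros a'(2) e'(2) simp: flat_ext_def b_def algebra_simps)
    moreover have *: "\<forall>\<^sub>F s in nhds (u i). flat_ext a (u(i := s)) = a (u(i := s)) * exp (- energy (u(i := s)))"
      using eventually_line[OF open_pos_set True i] by eventually_elim (simp add: flat_ext_def)
    ultimately show ?thesis
      using DERIV_cong_ev[OF refl * refl] by simp
  next
    case False
    then obtain x0 where x0: "x0 \<in> {0..1}" "g (u(n := x0)) = 0"
      using zero_if_not_pos[OF u] by blast
    obtain C where C: "\<forall>\<^sub>F w in at u within U. \<bar>flat_ext a w\<bar> \<le> C * (g (w(n := x0)))\<^sup>2"
      using flat_ext_bound[OF a u x0(1)] by blast
    have "((\<lambda>s. g ((u(n := x0))(i := s))) has_real_derivative partial_deriv i g (u(n := x0))) (at ((u(n := x0)) i))"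
      using i by (intro smooth_on_has_partial_deriv[OF smooth_g] upd_in_times_real[OF open_U u]) simp
    moreover have "(u(n := x0))(i := s) = u(i := s, n := x0)" for s
      using i by (auto simp: fun_upd_twist)
    ultimately have Dg: "((\<lambda>s. g (u(i := s, n := x0))) has_real_derivative partial_deriv i g (u(n := x0))) (at (u i))"
      using i by simp
    have "((\<lambda>s. flat_ext a (u(i := s))) has_real_derivative 0) (at (u i))"
    proof (rule has_real_derivative_zero_if_dominated)
      show "\<forall>\<^sub>F s in at (u i). \<bar>flat_ext a (u(i := s))\<bar> \<le> C * (g (u(i := s, n := x0)))\<^sup>2"
        using filterlim_iff[THEN iffD1, OF filterlim_line_at_within[OF open_U u i], rule_format, OF C] by simp
      show "((\<lambda>s. C * (g (u(i := s, n := x0)))\<^sup>2) has_real_derivative 0) (at (u i))"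
        by (rule derivative_eq_intros Dg refl)+ (simp add: x0(2))
    qed (use False x0(2) in \<open>auto simp: flat_ext_def\<close>)
    then show ?thesis using False by (simp add: flat_ext_def)
  qed
  ultimately show ?thesis by blast
qed

lemma smooth_on_flat_ext:
  assumes "coeff a"
  shows "smooth_on n U (flat_ext a)"
proof (rule smooth_on_coinduct[OF open_U, of _ "flat_ext ` Collect coeff"])
  show "flat_ext a \<in> flat_ext ` Collect coeff" using assms by simp
  show "continuous_on U f" if "f \<in> flat_ext ` Collect coeff" for f
    using that continuous_on_flat_ext by auto
  show "\<exists>b\<in>flat_ext ` Collect coeff. \<forall>u\<in>U. ((\<lambda>s. f (u(i := s))) has_real_derivative b u) (at (u i))"
    if "f \<in> flat_ext ` Collect coeff" "i < n" for f i
    using that flat_ext_has_partial_derivative by fastforce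
qed

end

section \<open>The smooth map\<close>

definition zero_detector :: "(real \<Rightarrow> real) \<Rightarrow> real" where
  "zero_detector f = (if \<exists>x\<in>{0..1}. f x = 0 then 0 else exp (- integral {0..1} (\<lambda>x. 1 / (f x)\<^sup>2)))"

lemma smooth_map_zero_detector:
  "smooth_map smooth_nonneg_diffeology nonneg_real_diffeology zero_detector"
  unfolding smooth_map_def
proof (intro conjI allI impI)
  show "zero_detector \<in> dspace smooth_nonneg_diffeology \<rightarrow> dspace nonneg_real_diffeology"
    by (simp add: nonneg_real_diffeology_def zero_detector_def)
  fix n U p assume "plot smooth_nonneg_diffeology n U p"
  then have U: "openin (Euclidean_space n) U" and p: "p \<in> U \<rightarrow> smooth_nonneg_funs"
    and sm: "smooth_on (Suc n) (times_real n U) (\<lambda>v. p (v(n := 0)) (v n))" by auto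
  define g where "g v = p (v(n := 0)) (v n)" for v
  interpret nonneg_family n U g
  proof
    show "smooth_on (Suc n) (times_real n U) g" using sm by (simp add: g_def[abs_def])
    show "0 \<le> g v" if "v \<in> times_real n U" for v
      using that p by (auto simp: g_def times_real_def smooth_nonneg_funs_def Pi_iff)
  qed fact
  have "flat_ext (\<lambda>_. 1) u = zero_detector (p u)" if u: "u \<in> U" for u
  proof -
    have "u(n := 0) = u" using openin_Euclidean_subset[OF U u, of n] by auto
    then have g: "g (u(n := x)) = p u x" for x by (simp add: g_def)
    have "0 \<le> p u x" for x using p u by (auto simp: smooth_nonneg_funs_def Pi_iff)
    then have "u \<in> pos_set \<longleftrightarrow> \<not> (\<exists>x\<in>{0..1}. p u x = 0)"
      using u by (force simp: pos_set_def g order_less_le)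
    then show ?thesis by (simp add: flat_ext_def zero_detector_def energy_def weighted_integral_def g)
  qed
  then have "smooth_on n U (\<lambda>u. zero_detector (p u))"
    by (rule smooth_on_cong[OF U smooth_on_flat_ext[OF coeff_const]])
  then show "plot nonneg_real_diffeology n U (\<lambda>u. zero_detector (p u))"
    using U by (simp add: nonneg_real_diffeology_def zero_detector_def)
qed

theorem propositionA4:
  shows "\<exists>F. smooth_map smooth_nonneg_diffeology nonneg_real_diffeology F \<and>
    (\<forall>f\<in>smooth_nonneg_funs. F f = 0 \<longleftrightarrow> (\<exists>x\<in>{0..1}. f x = 0))"
  using smooth_map_zero_detector
  by (intro exI[of _ zero_detector]) (auto simp: zero_detector_def)

end
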